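(* Fix a unit vector $u\in V$ with corresponding unit imaginary octonion $\hat u$, and consider the slice $\mathbb C_{\hat u}=\mathbb R\oplus\mathbb R\hat u\subset\mathbb O$. Then the octonionic right eigenvalues $\lambda=\mu+Q\hat u$ ($\mu,Q\in\mathbb R$) of $h$ in this slice are precisely those for which $(\mu,Q)\in\mathbb R^2$ lies on one of the following two loci: (1) the quartic curve $$\mu^4+6\mu^3+(2Q^2-15)\mu^2+(6Q^2-56)\mu+Q^4+Q^2=0,$$ arising from the $\mathbf 1^{\oplus4}$-block; (2) the circle $$(\mu+2)^2+Q^2=4,$$ arising from the $\mathbf 8^{\oplus2}$-block. The $\mathbf 6^{\oplus4}$- and $\mathbf{12}$-blocks contribute no right eigenvalues with $Q\neq0$. Equivalently, the non-real octonionic right eigenvalues of $h$ in the slice $\mathbb C_{\hat u}$ are exactly those $\lambda=\mu+Q\hat u$ with $Q\ne0$ for which $(\mu,Q)$ lies on the quartic or on the circle.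
   Context: $\mathbb O$ is the octonion algebra. $V$ is an oriented Euclidean $7$-dimensional real vector space with metric $g$ and a fixed isometric identification $V\cong\hat V:=\operatorname{Im}\mathbb O$, $v\mapsto\hat v$; only hatted vectors are multiplied in $\mathbb O$. $G_2=\operatorname{Aut}(\mathbb O)$ acts on $\operatorname{Im}\mathbb O\cong V$ and diagonally on $W=\mathbb O\otimes_{\mathbb R}V$. Fix an orthonormal basis $e_1,\dots,e_7$ of $V$ with corresponding basis $\hat e_1,\dots,\hat e_7$ of $\hat V$; repeated indices are summed. The real-linear operator $h:W\to W$ (independent of the basis) is $h(\hat w)=\big((\hat e_i\hat e_j)\hat w_j\big)\otimes e_i$ for $\hat w=\hat w_j\otimes e_j$, $\hat w_j\in\mathbb O$. Right multiplication on $W$ is $R_a(x\otimes v)=(xa)\otimes v$, and $\hat w\lambda:=R_\lambda(\hat w)$. A right eigenvalue of $h$ is $\lambda\in\mathbb O$ such that $h(\hat w)=\hat w\lambda$ for some nonzero $\hat w\in W$. The stabilizer of $u$ in $G_2$ is a copy of $\mathrm{SU}(3)$, and $u^\perp$ has the complex structure $J_u(v)=u\times v$ (the cross product being defined by $\hat a\hat b=-g(a,b)1+\hat a\times\hat b$). As a real $\mathrm{SU}(3)$-module, $W\cong\mathbf 1^{\oplus4}\oplus\mathbf 6^{\oplus4}\oplus\mathbf 8^{\oplus2}\oplus\mathbf{12}$, where $\mathbf 1$ is trivial, $\mathbf 6=u^\perp$, $\mathbf 8=\mathfrak{su}(u^\perp,J_u)$ is the adjoint representation, and $\mathbf{12}$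 is the real representation with complexification $S^2(\mathbf 3)\oplus S^2(\overline{\mathbf 3})$. The isotypic components are called blocks; a block contributes a right eigenvalue $\lambda$ if $h(\hat w)=\hat w\lambda$ for some nonzero $\hat w$ in that block. (Both $h$ and $R_{\hat u}$ preserve each block.) *)

theory Defs
  imports "HOL-Analysis.Analysis"
begin

section \<open>Octonions\<close>

text \<open>
  Two Cayley--Dickson doublings of the complex numbers, with
  \<open>(a, b) (c, d) = (a c - d\<^sup>* b, d a + b c\<^sup>*)\<close>.  The Euclidean structure is the one that the
  library puts on products.
\<close>

type_synonym quaternion = "complex \<times> complex"
type_synonym octonion = "quaternion \<times> quaternion"

definition qconj :: "quaternion \<Rightarrow> quaternion" where
  "qconj q = (cnj (fst q), - snd q)"

definition qmult :: "quaternion \<Rightarrow> quaternion \<Rightarrow> quaternion" where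
  "qmult p q = (fst p * fst q - cnj (snd q) * snd p, snd q * fst p + snd p * cnj (fst q))"

definition omult :: "octonion \<Rightarrow> octonion \<Rightarrow> octonion"  (infixl "\<odot>" 70) where
  "x \<odot> y = (qmult (fst x) (fst y) - qmult (qconj (snd y)) (snd x),
             qmult (snd y) (fst x) + qmult (snd x) (qconj (fst y)))"

definition oone :: octonion where
  "oone = ((1, 0), (0, 0))"

definition ImO :: "octonion set" where
  "ImO = {x. Re (fst (fst x)) = 0}"

text \<open>\<open>G\<^sub>2\<close> is the group of automorphisms of the real algebra of octonions.\<close>

definition G2 :: "(octonion \<Rightarrow> octonion) set" where
  "G2 = {g. linear g \<and> bij g \<and> (\<forall>x y. g (x \<odot> y) = g x \<odot> g y)}"


section \<open>The space \<open>V\<close>\<close>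

text \<open>
  \<open>V\<close> is a Euclidean space \<open>'v\<close> with an isometric identification \<open>hat\<close> onto \<open>ImO\<close>, which forces
  the dimension to be 7 and carries an orientation of \<open>ImO\<close> over to \<open>V\<close>.
\<close>

definition isometric_identification :: "('v::euclidean_space \<Rightarrow> octonion) \<Rightarrow> bool" where
  "isometric_identification hat \<longleftrightarrow>
     linear hat \<and> (\<forall>v. norm (hat v) = norm v) \<and> range hat = ImO"

definition orthonormal_basis :: "(7 \<Rightarrow> 'v::euclidean_space) \<Rightarrow> bool" where
  "orthonormal_basis e \<longleftrightarrow> (\<forall>i j. e i \<bullet> e j = (if i = j then 1 else 0)) \<and> span (range e) = UNIV"

definition actV :: "('v::euclidean_space \<Rightarrow> octonion) \<Rightarrow> (octonion \<Rightarrow> octonion) \<Rightarrow> 'v \<Rightarrow> 'v" where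
  "actV hat g v = inv hat (g (hat v))"

definition crossV :: "('v::euclidean_space \<Rightarrow> octonion) \<Rightarrow> 'v \<Rightarrow> 'v \<Rightarrow> 'v" where
  "crossV hat a b = inv hat (hat a \<odot> hat b + (a \<bullet> b) *\<^sub>R oone)"

text \<open>The stabilizer of \<open>u\<close> in \<open>G\<^sub>2\<close>, a copy of \<open>SU(3)\<close>.\<close>

definition SU3 :: "('v::euclidean_space \<Rightarrow> octonion) \<Rightarrow> 'v \<Rightarrow> (octonion \<Rightarrow> octonion) set" where
  "SU3 hat u = {g \<in> G2. actV hat g u = u}"


section \<open>The space \<open>W = O \<otimes> V\<close> and the operator \<open>h\<close>\<close>

text \<open>
  With respect to the orthonormal basis \<open>e\<close>, the element \<open>\<Sum>\<^sub>j w\<^sub>j \<otimes> e\<^sub>j\<close> of \<open>O \<otimes> V\<close> is represented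
  by the vector of its octonionic components \<open>w\<^sub>j\<close>.
\<close>

type_synonym W = "octonion ^ 7"

definition tensor :: "(7 \<Rightarrow> 'v::euclidean_space) \<Rightarrow> octonion \<Rightarrow> 'v \<Rightarrow> W" where
  "tensor e x v = (\<chi> j. (v \<bullet> e j) *\<^sub>R x)"

lemma bilinear_tensor: "bilinear (tensor e)"
  by (auto simp: bilinear_def tensor_def vec_eq_iff inner_add_left algebra_simps
      intro!: linearI)

lemma tensor_decomposition:
  assumes "orthonormal_basis e"
  shows "w = (\<Sum>j\<in>UNIV. tensor e (w $ j) (e j))"
proof -
  have "(\<Sum>j\<in>UNIV. (e j \<bullet> e i) *\<^sub>R (w $ j)) = w $ i" for i
  proof -
    have "(\<Sum>j\<in>UNIV. (e j \<bullet> e i) *\<^sub>R (w $ j)) = (\<Sum>j\<in>UNIV. if j = i then w $ j else 0)"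
      using assms by (intro sum.cong) (auto simp: orthonormal_basis_def)
    then show ?thesis by simp
  qed
  then show ?thesis
    by (simp add: vec_eq_iff tensor_def)
qed

definition h :: "('v::euclidean_space \<Rightarrow> octonion) \<Rightarrow> (7 \<Rightarrow> 'v) \<Rightarrow> W \<Rightarrow> W" where
  "h hat e w = (\<Sum>i\<in>UNIV. \<Sum>j\<in>UNIV. tensor e ((hat (e i) \<odot> hat (e j)) \<odot> w $ j) (e i))"

definition rmul :: "(7 \<Rightarrow> 'v::euclidean_space) \<Rightarrow> octonion \<Rightarrow> W \<Rightarrow> W" where
  "rmul e a w = (\<Sum>j\<in>UNIV. tensor e (w $ j \<odot> a) (e j))"

definition actW ::
  "('v::euclidean_space \<Rightarrow> octonion) \<Rightarrow> (7 \<Rightarrow> 'v) \<Rightarrow> (octonion \<Rightarrow> octonion) \<Rightarrow> W \<Rightarrow> W" where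
  "actW hat e g w = (\<Sum>j\<in>UNIV. tensor e (g (w $ j)) (actV hat g (e j)))"

definition contributes ::
  "('v::euclidean_space \<Rightarrow> octonion) \<Rightarrow> (7 \<Rightarrow> 'v) \<Rightarrow> W set \<Rightarrow> octonion \<Rightarrow> bool" where
  "contributes hat e B lam \<longleftrightarrow> (\<exists>w\<in>B. w \<noteq> 0 \<and> h hat e w = rmul e lam w)"

definition right_eigenvalue ::
  "('v::euclidean_space \<Rightarrow> octonion) \<Rightarrow> (7 \<Rightarrow> 'v) \<Rightarrow> octonion \<Rightarrow> bool" where
  "right_eigenvalue hat e lam \<longleftrightarrow> (\<exists>w. w \<noteq> 0 \<and> h hat e w = rmul e lam w)"


section \<open>Real representations and isotypic components\<close>

definition submodule :: "'g set \<Rightarrow> ('g \<Rightarrow> 'a \<Rightarrow> 'a) \<Rightarrow> 'a::real_vector set \<Rightarrow> bool" where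
  "submodule G act U \<longleftrightarrow> subspace U \<and> (\<forall>g\<in>G. \<forall>x\<in>U. act g x \<in> U)"

text \<open>
  The isomorphism is given as the restriction of a linear map on the ambient spaces; every linear
  map on a subspace arises in this way.
\<close>

definition module_iso ::
  "'g set \<Rightarrow> ('g \<Rightarrow> 'a \<Rightarrow> 'a) \<Rightarrow> 'a::real_vector set \<Rightarrow>
   ('g \<Rightarrow> 'b \<Rightarrow> 'b) \<Rightarrow> 'b::real_vector set \<Rightarrow> bool" where
  "module_iso G act U act' M \<longleftrightarrow>
     (\<exists>\<phi>. linear \<phi> \<and> bij_betw \<phi> U M \<and> (\<forall>g\<in>G. \<forall>x\<in>U. \<phi> (act g x) = act' g (\<phi> x)))"

text \<open>The sum of all submodules whose isomorphism type is described by \<open>is_type\<close>.\<close>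

definition isotypic_component ::
  "'g set \<Rightarrow> ('g \<Rightarrow> 'a \<Rightarrow> 'a) \<Rightarrow> ('a::real_vector set \<Rightarrow> bool) \<Rightarrow> 'a set" where
  "isotypic_component G act is_type = span (\<Union>{U. submodule G act U \<and> is_type U})"


section \<open>The four blocks\<close>

definition block1 :: "('v::euclidean_space \<Rightarrow> octonion) \<Rightarrow> (7 \<Rightarrow> 'v) \<Rightarrow> 'v \<Rightarrow> W set" where
  "block1 hat e u = isotypic_component (SU3 hat u) (actW hat e)
     (\<lambda>U. module_iso (SU3 hat u) (actW hat e) U (\<lambda>g x. x) (UNIV :: real set))"

definition block6 :: "('v::euclidean_space \<Rightarrow> octonion) \<Rightarrow> (7 \<Rightarrow> 'v) \<Rightarrow> 'v \<Rightarrow> W set" where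
  "block6 hat e u = isotypic_component (SU3 hat u) (actW hat e)
     (\<lambda>U. module_iso (SU3 hat u) (actW hat e) U (actV hat) {v. v \<bullet> u = 0})"

text \<open>
  Endomorphisms of \<open>u\<^sup>\<bottom>\<close> are extended to \<open>V\<close> by \<open>u \<mapsto> 0\<close>.  The complex trace of a \<open>J\<close>-linear real
  endomorphism \<open>A\<close> is \<open>(tr A - \<i> tr (J A)) / 2\<close> in terms of real traces.
\<close>

definition ctrace :: "(7 \<Rightarrow> 'v::euclidean_space) \<Rightarrow> ('v \<Rightarrow> 'v) \<Rightarrow> ('v \<Rightarrow> 'v) \<Rightarrow> complex" where
  "ctrace e J A = Complex (\<Sum>i\<in>UNIV. A (e i) \<bullet> e i) (- (\<Sum>i\<in>UNIV. J (A (e i)) \<bullet> e i)) / 2"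

definition su_perp ::
  "('v::euclidean_space \<Rightarrow> octonion) \<Rightarrow> (7 \<Rightarrow> 'v) \<Rightarrow> 'v \<Rightarrow> ('v \<Rightarrow>\<^sub>L 'v) set" where
  "su_perp hat e u = {A :: 'v \<Rightarrow>\<^sub>L 'v. A u = 0 \<and> (\<forall>x y. A x \<bullet> y = - (x \<bullet> A y)) \<and>
     (\<forall>x. A (crossV hat u x) = crossV hat u (A x)) \<and> ctrace e (crossV hat u) A = 0}"

definition actEnd ::
  "('v::euclidean_space \<Rightarrow> octonion) \<Rightarrow> (octonion \<Rightarrow> octonion) \<Rightarrow> ('v \<Rightarrow>\<^sub>L 'v) \<Rightarrow> ('v \<Rightarrow>\<^sub>L 'v)" where
  "actEnd hat g A = Blinfun (\<lambda>x. actV hat g (A (actV hat (inv g) x)))"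

definition block8 :: "('v::euclidean_space \<Rightarrow> octonion) \<Rightarrow> (7 \<Rightarrow> 'v) \<Rightarrow> 'v \<Rightarrow> W set" where
  "block8 hat e u = isotypic_component (SU3 hat u) (actW hat e)
     (\<lambda>U. module_iso (SU3 hat u) (actW hat e) U (actEnd hat) (su_perp hat e u))"

text \<open>
  The symmetric square of the complex dual of \<open>(u\<^sup>\<bottom>, J)\<close>, as the symmetric complex bilinear forms on
  \<open>u\<^sup>\<bottom>\<close>, extended to \<open>V\<close> by zero.  The hermitian metric identifies the dual of
  \<open>(u\<^sup>\<bottom>, J)\<close> with the conjugate space \<open>(u\<^sup>\<bottom>, - J)\<close>, and the dual of the latter with
  \<open>(u\<^sup>\<bottom>, J)\<close>.  With the 3-dimensional representation being \<open>(u\<^sup>\<bottom>, J)\<close>, its symmetric square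
  is therefore obtained from \<open>- J\<close>, and that of its conjugate from \<open>J\<close>.
\<close>

definition S2_dual :: "'v::euclidean_space \<Rightarrow> ('v \<Rightarrow> 'v) \<Rightarrow> ('v \<Rightarrow>\<^sub>L 'v \<Rightarrow>\<^sub>L complex) set" where
  "S2_dual u J = {\<beta> :: 'v \<Rightarrow>\<^sub>L 'v \<Rightarrow>\<^sub>L complex. (\<forall>x. blinfun_apply (\<beta> u) x = 0) \<and>
     (\<forall>x y. blinfun_apply (\<beta> x) y = blinfun_apply (\<beta> y) x) \<and>
     (\<forall>x y. blinfun_apply (\<beta> (J x)) y = \<i> * blinfun_apply (\<beta> x) y)}"

definition S2_3 ::
  "('v::euclidean_space \<Rightarrow> octonion) \<Rightarrow> 'v \<Rightarrow> ('v \<Rightarrow>\<^sub>L 'v \<Rightarrow>\<^sub>L complex) set" where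
  "S2_3 hat u = S2_dual u (\<lambda>x. - crossV hat u x)"

definition S2_3bar ::
  "('v::euclidean_space \<Rightarrow> octonion) \<Rightarrow> 'v \<Rightarrow> ('v \<Rightarrow>\<^sub>L 'v \<Rightarrow>\<^sub>L complex) set" where
  "S2_3bar hat u = S2_dual u (crossV hat u)"

definition actForm ::
  "('v::euclidean_space \<Rightarrow> octonion) \<Rightarrow> (octonion \<Rightarrow> octonion) \<Rightarrow>
   ('v \<Rightarrow>\<^sub>L 'v \<Rightarrow>\<^sub>L complex) \<Rightarrow> ('v \<Rightarrow>\<^sub>L 'v \<Rightarrow>\<^sub>L complex)" where
  "actForm hat g \<beta> =
     Blinfun (\<lambda>x. Blinfun (\<lambda>y. blinfun_apply (\<beta> (actV hat (inv g) x)) (actV hat (inv g) y)))"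

definition iForm :: "('v::euclidean_space \<Rightarrow>\<^sub>L 'v \<Rightarrow>\<^sub>L complex) \<Rightarrow> ('v \<Rightarrow>\<^sub>L 'v \<Rightarrow>\<^sub>L complex)" where
  "iForm \<beta> = Blinfun (\<lambda>x. Blinfun (\<lambda>y. \<i> * blinfun_apply (\<beta> x) y))"

text \<open>
  A real module \<open>U\<close> is of type \<open>12\<close> if its complexification is isomorphic to the direct sum of
  \<open>S2_3\<close> and \<open>S2_3bar\<close>.  The complexification is \<open>U \<times> U\<close>, with \<open>(x, y)\<close> in the role of
  \<open>x + \<i> y\<close>, so that multiplication by \<open>\<i>\<close> is \<open>(x, y) \<mapsto> (- y, x)\<close>.
\<close>

definition is_type12 ::
  "('v::euclidean_space \<Rightarrow> octonion) \<Rightarrow> (7 \<Rightarrow> 'v) \<Rightarrow> 'v \<Rightarrow> W set \<Rightarrow> bool" where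
  "is_type12 hat e u U \<longleftrightarrow>
     (\<exists>\<Phi> :: W \<times> W \<Rightarrow> ('v \<Rightarrow>\<^sub>L 'v \<Rightarrow>\<^sub>L complex) \<times> ('v \<Rightarrow>\<^sub>L 'v \<Rightarrow>\<^sub>L complex).
        linear \<Phi> \<and> bij_betw \<Phi> (U \<times> U) (S2_3 hat u \<times> S2_3bar hat u) \<and>
        (\<forall>x\<in>U. \<forall>y\<in>U. \<Phi> (- y, x) = map_prod iForm iForm (\<Phi> (x, y))) \<and>
        (\<forall>g\<in>SU3 hat u. \<forall>x\<in>U. \<forall>y\<in>U.
           \<Phi> (actW hat e g x, actW hat e g y) =
           map_prod (actForm hat g) (actForm hat g) (\<Phi> (x, y))))"

definition block12 :: "('v::euclidean_space \<Rightarrow> octonion) \<Rightarrow> (7 \<Rightarrow> 'v) \<Rightarrow> 'v \<Rightarrow> W set" where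
  "block12 hat e u = isotypic_component (SU3 hat u) (actW hat e) (is_type12 hat e u)"


section \<open>The two loci\<close>

definition quartic :: "(real \<times> real) set" where
  "quartic = {(\<mu>, Q). \<mu>^4 + 6 * \<mu>^3 + (2 * Q^2 - 15) * \<mu>^2 + (6 * Q^2 - 56) * \<mu> + Q^4 + Q^2 = 0}"

definition circle :: "(real \<times> real) set" where
  "circle = {(\<mu>, Q). (\<mu> + 2)^2 + Q^2 = 4}"

definition slice_point :: "('v::euclidean_space \<Rightarrow> octonion) \<Rightarrow> 'v \<Rightarrow> real \<Rightarrow> real \<Rightarrow> octonion" where
  "slice_point hat u \<mu> Q = \<mu> *\<^sub>R oone + Q *\<^sub>R hat u"

end

theory Submission
  imports Defs
begin

text \<open>
  Write \<open>C\<close> for the slice spanned by 1 and the unit vector \<open>u\<close>, and split the octonions as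
  \<open>C \<oplus> C\<^sup>3\<close>, where left multiplication by \<open>u\<close> is the complex structure of the orthogonal
  complement \<open>C\<^sup>3\<close>.  The product becomes
  \<open>(a, x) (b, y) = (a b - \<langle>x, y\<rangle>, a y + cnj b x + cnj (x \<times> y))\<close>, lemma \<open>oct_mult\<close>.  That every unit
  vector can be brought into this position is the transitivity of \<open>G\<^sub>2\<close> on the unit sphere, lemma
  \<open>G2_transitive\<close>; the automorphisms used for it are conjugations by Hurwitz units.

  By the metric, \<open>W\<close> is the space of real-linear maps from \<open>V = R u \<oplus> C\<^sup>3\<close> to \<open>C \<oplus> C\<^sup>3\<close>.  Such a map is
  given by complex coordinates: \<open>c\<close> in \<open>C\<close>, vectors \<open>d, p, q\<close> and \<open>3 \<times> 3\<close> matrices \<open>A\<close> (its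
  complex-linear part) and \<open>B\<close> (its antilinear part).  In these coordinates the eigenvalue equation
  \<open>h w = w (\<mu> + Q u)\<close> becomes, with \<open>z = \<mu> + \<i> Q\<close>, a short system that falls apart into blocks
  (lemma \<open>eigen_iff\<close>):

  \<^item> For \<open>c\<close> and the trace of \<open>A\<close>, eliminating the trace gives
    \<open>(z - 1) (z + 4) c = 4 (1 + cnj z) cnj c\<close>.  An equation \<open>\<alpha> c = \<beta> cnj c\<close> has a nonzero solution
    exactly when \<open>\<bar>\<alpha>\<bar> = \<bar>\<beta>\<bar>\<close>, and this condition is the quartic.

  \<^item> For a traceless \<open>A\<close> it says \<open>(2 + cnj z) A = 2 A\<^sup>*\<close>, which is solvable exactly when
    \<open>\<bar>2 + z\<bar> = 2\<close>, the circle.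

  \<^item> For \<open>d, p, q\<close> and the antisymmetric part of \<open>B\<close> the determinant vanishes only for \<open>Q = 0\<close> (lemma
    \<open>six_block_real\<close>), and for the symmetric part of \<open>B\<close> the equation is \<open>cnj z B = 0\<close>.  The real
    eigenvalues found here lie on the quartic or on the circle.

  It remains to identify the isotypic components, as far as needed.  The blocks are compared through
  elements of the group ring of \<open>SU(3)\<close> that act in a known way on the model of each
  representation, and hence on every submodule of \<open>W\<close> isomorphic to it.  The centre,
  generated by a cube root of unity \<open>\<omega>\<close>, fixes the blocks \<open>1\<close> and \<open>8\<close> and leaves
  only the coordinates \<open>c, A\<close> in them, whereas \<open>1 + \<omega> + \<omega>\<^sup>2\<close> annihilates the blocks \<open>6\<close> and \<open>12\<close>
  and leaves only \<open>d, p, q, B\<close>.  The sum over a tetrahedral group in \<open>SO(3)\<close> annihilates the block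
  \<open>8\<close>, but is 12 on the invariants and detects \<open>c\<close> and the trace of \<open>A\<close>.  Conversely, the
  eigenvectors for the quartic are invariant under the stabilizer, and those for the circle lie in the image of
  \<open>su_perp\<close> under left multiplication by an element of the slice.
\<close>

section \<open>Octonions in complex coordinates\<close>

text \<open>
  The complex line \<open>C\<close> spanned by \<open>1\<close> and \<open>\<i> = oct \<i> 0\<close> acts on its orthogonal complement
  by left multiplication.  The last of the four coordinates is conjugated because there this action
  is by \<open>- \<i>\<close> in the doubling construction; after conjugation it is \<open>oct 0 x \<mapsto> oct 0 (\<i> x)\<close>
  throughout.
\<close>

definition oct :: "complex \<Rightarrow> complex^3 \<Rightarrow> octonion" where
  "oct a x = ((a, x $ 1), (x $ 2, cnj (x $ 3)))"

definition conj_cross :: "complex^3 \<Rightarrow> complex^3 \<Rightarrow> complex^3" where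
  "conj_cross x y = vector [cnj (x$2 * y$3 - x$3 * y$2), cnj (x$3 * y$1 - x$1 * y$3),
                         cnj (x$1 * y$2 - x$2 * y$1)]"

definition herm :: "complex^3 \<Rightarrow> complex^3 \<Rightarrow> complex" where
  "herm x y = (\<Sum>k\<in>UNIV. x $ k * cnj (y $ k))"

lemma vec3_eq_iff: "x = (y :: 'a^3) \<longleftrightarrow> x $ 1 = y $ 1 \<and> x $ 2 = y $ 2 \<and> x $ 3 = y $ 3"
  by (simp add: vec_eq_iff forall_3)

lemma oct_eq_iff [simp]: "oct a x = oct b y \<longleftrightarrow> a = b \<and> x = y"
  by (auto simp: oct_def vec3_eq_iff)

lemma oct_cases: obtains a x where "w = oct a x"
proof
  show "w = oct (fst (fst w)) (vector [snd (fst w), fst (snd w), cnj (snd (snd w))])"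
    by (simp add: oct_def)
qed

text \<open>
  The product in terms of the data that \<open>SU(3)\<close> preserves: the hermitian form and the conjugated
  cross product, which comes from the complex volume form.
\<close>

lemma oct_mult:
  "oct a x \<odot> oct b y = oct (a * b - herm x y) (a *s y + cnj b *s x + conj_cross x y)"
  by (simp add: oct_def omult_def qmult_def qconj_def herm_def conj_cross_def sum_3 algebra_simps)

lemma oct_add: "oct a x + oct b y = oct (a + b) (x + y)"
  by (simp add: oct_def)

lemma oct_scaleR: "r *\<^sub>R oct a x = oct (r *\<^sub>R a) (r *\<^sub>R x)"
  by (simp add: oct_def)

lemma oone_oct: "oone = oct 1 0"
  by (simp add: oone_def oct_def)

lemma zero_oct: "0 = oct 0 0"
  by (simp add: oct_def zero_prod_def)

lemma oct_ImO [simp]: "oct a x \<in> ImO \<longleftrightarrow> Re a = 0"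
  by (simp add: oct_def ImO_def)

lemma inner_oct: "oct a x \<bullet> oct b y = Re (a * cnj b + herm x y)"
  by (simp add: oct_def inner_complex_def herm_def sum_3)

lemma bilinear_omult: "bilinear (\<odot>)"
  unfolding bilinear_def
  by (auto intro!: linearI simp: omult_def qmult_def qconj_def algebra_simps scaleR_conv_of_real)

lemmas omult_add_left = bilinear_ladd [OF bilinear_omult]
  and omult_add_right = bilinear_radd [OF bilinear_omult]
  and omult_diff_left = bilinear_lsub [OF bilinear_omult]
  and omult_diff_right = bilinear_rsub [OF bilinear_omult]
  and omult_minus_left = bilinear_lneg [OF bilinear_omult]
  and omult_minus_right = bilinear_rneg [OF bilinear_omult]
  and omult_scaleR_left = bilinear_lmul [OF bilinear_omult]
  and omult_scaleR_right = bilinear_rmul [OF bilinear_omult]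
  and omult_zero_left = bilinear_lzero [OF bilinear_omult]
  and omult_zero_right = bilinear_rzero [OF bilinear_omult]

lemmas omult_simps = omult_add_left omult_add_right omult_diff_left omult_diff_right
  omult_minus_left omult_minus_right omult_scaleR_left omult_scaleR_right
  omult_zero_left omult_zero_right

lemma oone_left [simp]: "oone \<odot> x = x" and oone_right [simp]: "x \<odot> oone = x"
  by (simp_all add: oone_def omult_def qmult_def qconj_def prod_eq_iff)

lemma omult_left_alternative: "a \<odot> (a \<odot> x) = (a \<odot> a) \<odot> x"
  by (cases a; cases x) (simp add: omult_def qmult_def qconj_def algebra_simps)

lemma omult_right_alternative: "(x \<odot> a) \<odot> a = x \<odot> (a \<odot> a)"
  by (cases a; cases x) (simp add: omult_def qmult_def qconj_def algebra_simps)

lemma omult_flexible: "(a \<odot> x) \<odot> a = a \<odot> (x \<odot> a)"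
  by (cases a; cases x) (simp add: omult_def qmult_def qconj_def algebra_simps)

lemma omult_middle_Moufang: "(a \<odot> x) \<odot> (y \<odot> a) = (a \<odot> (x \<odot> y)) \<odot> a"
  by (cases a; cases x; cases y) (simp add: omult_def qmult_def qconj_def algebra_simps)

lemma omult_right_Moufang: "((x \<odot> a) \<odot> y) \<odot> a = x \<odot> ((a \<odot> y) \<odot> a)"
  by (cases a; cases x; cases y) (simp add: omult_def qmult_def qconj_def algebra_simps)

lemma ImO_anticommutator:
  assumes "x \<in> ImO" "y \<in> ImO"
  shows "x \<odot> y + y \<odot> x = - (2 * (x \<bullet> y)) *\<^sub>R oone"
  using assms
  by (simp add: ImO_def omult_def qmult_def qconj_def oone_def inner_prod_def inner_complex_def
      prod_eq_iff complex_eq_iff algebra_simps)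

lemma ImO_square: "x \<in> ImO \<Longrightarrow> x \<odot> x = - ((norm x)\<^sup>2) *\<^sub>R oone"
  using ImO_anticommutator [of x x] by (simp add: dot_square_norm flip: scaleR_2 scaleR_scaleR scaleR_minus_right)

lemma subspace_ImO: "subspace ImO"
  by (auto simp: subspace_def ImO_def)

lemma ImO_inner: "x \<in> ImO \<longleftrightarrow> x \<bullet> oone = 0"
  by (simp add: ImO_def oone_def inner_complex_def inner_prod_def)

section \<open>Automorphisms of the octonions\<close>

lemma G2_linear: "g \<in> G2 \<Longrightarrow> linear g"
  and G2_bij: "g \<in> G2 \<Longrightarrow> bij g"
  and G2_mult: "g \<in> G2 \<Longrightarrow> g (x \<odot> y) = g x \<odot> g y"
  unfolding G2_def by blast+

lemma G2_inv:
  assumes "g \<in> G2" shows "inv g \<in> G2"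
proof -
  have b: "bij g" and l: "linear g" using assms by (auto simp: G2_def)
  have "linear (inv g)"
    using b l by (metis bij_is_inj bij_is_surj linear_injective_left_inverse linear_inverse_left
        inv_unique_comp surj_iff inj_iff)
  moreover have "inv g (x \<odot> y) = inv g x \<odot> inv g y" for x y
    by (metis G2_mult assms b bij_inv_eq_iff)
  ultimately show ?thesis
    using b unfolding G2_def by (blast intro: bij_imp_bij_inv)
qed

lemma G2_comp: "f \<in> G2 \<Longrightarrow> g \<in> G2 \<Longrightarrow> f \<circ> g \<in> G2"
  unfolding G2_def by (auto simp del: split_paired_All intro: linear_compose bij_comp)

lemma G2_oone:
  assumes "g \<in> G2" shows "g oone = oone"
proof -
  obtain x where x: "g x = oone" using G2_bij [OF assms] by (metis bij_pointE)
  then show ?thesis using G2_mult [OF assms, of oone x] by simp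
qed

text \<open>
  Automorphisms are orthogonal because the imaginary octonions of norm \<open>r\<close> are exactly those
  whose square is \<open>- r\<^sup>2\<close>, a property which automorphisms preserve.
\<close>

lemma G2_ImO_norm:
  assumes g: "g \<in> G2" and x: "x \<in> ImO"
  shows "g x \<in> ImO \<and> norm (g x) = norm x"
proof -
  obtain a v where av: "g x = oct a v" by (rule oct_cases)
  define r where "r = Re a"
  define y where "y = g x - r *\<^sub>R oone"
  have y: "y \<in> ImO" by (simp add: y_def av oone_oct oct_scaleR r_def ImO_def oct_def)
  have gx: "g x = r *\<^sub>R oone + y" by (simp add: y_def)
  have "g x \<odot> g x = g (x \<odot> x)" using G2_mult [OF g] by simp
  also have "\<dots> = - ((norm x)\<^sup>2) *\<^sub>R oone"
    using ImO_square [OF x] G2_oone [OF g] linear_scale [OF G2_linear [OF g]]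
      linear_neg [OF G2_linear [OF g]] by simp
  finally have "(r * r) *\<^sub>R oone + (2 * r) *\<^sub>R y - (norm y)\<^sup>2 *\<^sub>R oone = - ((norm x)\<^sup>2) *\<^sub>R oone"
    unfolding gx by (simp add: omult_simps ImO_square [OF y] scaleR_2 flip: scaleR_scaleR)
      (simp add: algebra_simps)
  then have eq: "(r * r - (norm y)\<^sup>2 + (norm x)\<^sup>2) *\<^sub>R oone = - (2 * r) *\<^sub>R y"
    by (simp add: algebra_simps)
  have "oone \<bullet> oone = 1" by (simp add: oone_def inner_complex_def)
  moreover have "y \<bullet> oone = 0" using y ImO_inner by blast
  ultimately have "r * r - (norm y)\<^sup>2 + (norm x)\<^sup>2 = 0"
    using arg_cong [OF eq, of "\<lambda>z. z \<bullet> oone"] by simp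
  moreover from this eq have "r = 0 \<or> y = 0" by simp
  moreover have "x = 0" if "y = 0" "r * r + (norm x)\<^sup>2 = 0"
    using that by (metis add_nonneg_eq_0_iff norm_eq_zero power2_eq_square zero_eq_power2 zero_le_power2)
  ultimately have "r = 0 \<and> norm y = norm x"
    using linear_0 [OF G2_linear [OF g]] gx y
    by (smt (verit) add_nonneg_eq_0_iff norm_ge_zero norm_zero power2_eq_iff_nonneg power2_eq_square zero_eq_power2 zero_le_power2)
  then show ?thesis using y gx by simp
qed

lemma norm_isometry_inner:
  fixes f :: "'a::real_inner \<Rightarrow> 'b::real_inner"
  assumes "linear f" "subspace S" "\<And>x. x \<in> S \<Longrightarrow> norm (f x) = norm x" "x \<in> S" "y \<in> S"
  shows "f x \<bullet> f y = x \<bullet> y"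
proof -
  have "norm (f (x + y)) = norm (x + y)"
    using assms by (simp add: subspace_add)
  then show ?thesis
    using assms by (simp add: dot_norm linear_add)
qed

lemma G2_inner: "g \<in> G2 \<Longrightarrow> x \<in> ImO \<Longrightarrow> y \<in> ImO \<Longrightarrow> g x \<bullet> g y = x \<bullet> y"
  using norm_isometry_inner [OF G2_linear subspace_ImO] G2_ImO_norm by blast

text \<open>
  For a unit \<open>a\<close> with \<open>a\<^sup>2 = a - 1\<close>, a sixth root of unity, the conjugate and inverse is
  \<open>1 - a\<close>.  Conjugation by \<open>a\<close> is then an automorphism although the octonions are not
  associative: because \<open>a\<^sup>3 = - 1\<close>, the conjugate \<open>a y (1 - a)\<close> is also \<open>- (a y a) a\<close>, and this second form fits
  the Moufang identities.
\<close>

lemma sixth_root_conjugation_G2: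
  assumes a: "a \<odot> a = a - oone"
  shows "(\<lambda>x. (a \<odot> x) \<odot> (oone - a)) \<in> G2"
proof -
  let ?C = "\<lambda>x. (a \<odot> x) \<odot> (oone - a)"
  have cancel: "(x \<odot> (oone - a)) \<odot> a = x" for x
    by (simp add: omult_simps omult_right_alternative a)
  have cancel': "(oone - a) \<odot> (a \<odot> x) = x" for x
    by (simp add: omult_simps omult_left_alternative a)
  have lin: "linear ?C"
    by (intro linearI) (simp_all add: omult_simps scaleR_diff_right)
  have "x = 0" if "?C x = 0" for x
  proof -
    have "a \<odot> x = 0" using cancel [of "a \<odot> x"] that by (simp add: omult_simps)
    then show "x = 0" using cancel' [of x] by (simp add: omult_simps)
  qed
  then have inj: "inj ?C"
    using lin by (simp add: linear_injective_0)
  have flip: "((a \<odot> y) \<odot> a) \<odot> a = - ?C y" for y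
    by (simp add: omult_right_alternative a omult_simps)
  have "?C (x \<odot> y) = ?C x \<odot> ?C y" for x y
  proof -
    let ?x = "x \<odot> (oone - a)" and ?y = "(a \<odot> y) \<odot> a"
    \<comment> \<open>the right Moufang identity absorbs one pair of factors, the middle one the other\<close>
    have xy: "?x \<odot> ?y = (x \<odot> y) \<odot> a"
      using omult_right_Moufang [of ?x a y] by (simp add: cancel)
    have ax: "a \<odot> ?x = ?C x"
      by (simp add: omult_simps omult_flexible)
    have "?C x \<odot> ?C y = - ((a \<odot> ?x) \<odot> (?y \<odot> a))"
      by (simp add: flip ax omult_minus_right)
    also have "\<dots> = - ((a \<odot> ((x \<odot> y) \<odot> a)) \<odot> a)"
      by (simp add: omult_middle_Moufang xy)
    also have "\<dots> = ?C (x \<odot> y)"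
      using flip [of "x \<odot> y"] by (simp add: omult_flexible)
    finally show ?thesis by simp
  qed
  then show ?thesis
    using lin inj linear_injective_imp_surjective [OF lin inj] unfolding G2_def bij_def by blast
qed

text \<open>
  In the quaternions spanned by \<open>1, x, y, x y\<close>, conjugation by the Hurwitz unit
  \<open>(1 + x + y + x y) / 2\<close> permutes \<open>x\<close>, \<open>y\<close>, \<open>x y\<close> cyclically.
\<close>

lemma G2_transitive_orthogonal:
  assumes x: "x \<in> ImO" "norm x = 1" and y: "y \<in> ImO" "norm y = 1" and "x \<bullet> y = 0"
  obtains g where "g \<in> G2" "g x = y"
proof
  define k where "k = x \<odot> y"
  define a where "a = (1/2) *\<^sub>R (oone + x + y + k)"
  have xx: "x \<odot> x = - oone" and yy: "y \<odot> y = - oone"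
    using ImO_square x y by auto
  have yx: "y \<odot> x = - k"
    using ImO_anticommutator [OF x(1) y(1)] assms by (simp add: k_def eq_neg_iff_add_eq_0 add.commute)
  have xk: "x \<odot> k = - y" by (simp add: k_def omult_left_alternative xx omult_simps)
  have ky: "k \<odot> y = - x" by (simp add: k_def omult_right_alternative yy omult_simps)
  have kx: "k \<odot> x = y"
    using omult_flexible [of x y] by (simp add: k_def yx omult_simps xk [unfolded k_def])
  have yk: "y \<odot> k = x"
    using omult_flexible [of y x] by (simp add: yx omult_simps ky flip: k_def)
  have "k \<odot> (y \<odot> x) = oone"
    using omult_middle_Moufang [of x y y] by (simp add: k_def yy xx omult_simps)
  then have kk: "k \<odot> k = - oone" by (simp add: yx omult_simps neg_equal_iff_equal eq_neg_iff_add_eq_0 minus_equation_iff)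
  note table = xx yy yx xk ky kx yk kk k_def [symmetric]
  have aa: "a \<odot> a = a - oone"
    unfolding a_def by (simp add: omult_simps table algebra_simps) (simp flip: scaleR_add_left)
  show "(\<lambda>x. (a \<odot> x) \<odot> (oone - a)) \<in> G2"
    by (rule sixth_root_conjugation_G2 [OF aa])
  have "a \<odot> x = y \<odot> a"
    unfolding a_def by (simp add: omult_simps table algebra_simps)
  then show "(a \<odot> x) \<odot> (oone - a) = y"
    by (simp add: omult_simps omult_right_alternative aa)
qed

text \<open>
  Any two unit vectors have a common orthogonal unit vector, through which the previous lemma can
  be applied twice.  Transitivity allows the given unit vector to be moved to the coordinate vector
  \<open>oct \<i> 0\<close>.
\<close>

lemma G2_transitive:
  assumes x: "x \<in> ImO" "norm x = 1" and y: "y \<in> ImO" "norm y = 1"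
  obtains g where "g \<in> G2" "g x = y"
proof -
  have "dim {oone, x, y} \<le> card {oone, x, y}" by (rule dim_le_card') simp
  also have "\<dots> \<le> 3" by (simp add: card_insert_if)
  finally have "dim {oone, x, y} < DIM(octonion)" by simp
  then obtain z where z: "z \<noteq> 0" "\<And>v. v \<in> span {oone, x, y} \<Longrightarrow> orthogonal z v"
    using orthogonal_to_subspace_exists by blast
  define n where "n = (1 / norm z) *\<^sub>R z"
  have zz: "z \<bullet> oone = 0" "z \<bullet> x = 0" "z \<bullet> y = 0"
    using z(2) by (auto simp: orthogonal_def span_base)
  then have n: "n \<in> ImO" "norm n = 1" "x \<bullet> n = 0" "n \<bullet> y = 0"
    using z(1) by (auto simp: n_def ImO_inner inner_commute)
  obtain f where "f \<in> G2" "f x = n" using G2_transitive_orthogonal x n by blast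
  moreover obtain g where "g \<in> G2" "g n = y" using G2_transitive_orthogonal y n by blast
  ultimately show ?thesis using that [of "g \<circ> f"] G2_comp by auto
qed

section \<open>Elements of \<open>W\<close> as linear maps\<close>

lemma omult_sum_left: "(\<Sum>i\<in>I. x i) \<odot> y = (\<Sum>i\<in>I. x i \<odot> y)"
  using linear_sum [of "\<lambda>x. x \<odot> y" x I] by (simp add: linearI omult_simps)

locale imaginary_octonions =
  fixes hat :: "'v::euclidean_space \<Rightarrow> octonion" and e :: "7 \<Rightarrow> 'v"
  assumes isometric: "isometric_identification hat" and orthonormal: "orthonormal_basis e"
begin

lemma hat_linear: "linear hat"
  and hat_norm: "norm (hat v) = norm v"
  and hat_ImO: "hat v \<in> ImO"
  using isometric by (auto simp: isometric_identification_def)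

lemma hat_inner: "hat a \<bullet> hat b = a \<bullet> b"
  using norm_isometry_inner [OF hat_linear subspace_UNIV] hat_norm by auto

lemma hat_inj: "inj hat"
proof (rule injI)
  fix x y assume "hat x = hat y"
  then have "norm (hat (x - y)) = 0" by (simp add: linear_diff [OF hat_linear])
  then show "x = y" by (simp add: hat_norm)
qed

lemma inv_hat_hat [simp]: "inv hat (hat v) = v"
  by (simp add: hat_inj)

lemma hat_inv_hat [simp]: "y \<in> ImO \<Longrightarrow> hat (inv hat y) = y"
  using isometric by (simp add: isometric_identification_def f_inv_into_f)

lemma hat_actV: "g \<in> G2 \<Longrightarrow> hat (actV hat g v) = g (hat v)"
  by (simp add: actV_def G2_ImO_norm hat_ImO)

lemma actV_linear: "g \<in> G2 \<Longrightarrow> linear (actV hat g)"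
  by (intro linearI injD [OF hat_inj])
    (simp_all add: hat_actV linear_add [OF hat_linear] linear_scale [OF hat_linear]
      linear_add [OF G2_linear] linear_scale [OF G2_linear])

lemma actV_inner: "g \<in> G2 \<Longrightarrow> actV hat g a \<bullet> actV hat g b = a \<bullet> b"
  by (simp add: hat_actV G2_inner hat_ImO hat_inner flip: hat_inner [of "actV hat g a"])

lemma actV_actV_inv [simp]: "g \<in> G2 \<Longrightarrow> actV hat g (actV hat (inv g) v) = v"
  by (intro injD [OF hat_inj]) (simp add: hat_actV G2_inv surj_f_inv_f bij_is_surj G2_bij)

lemma actV_inv_actV [simp]: "g \<in> G2 \<Longrightarrow> actV hat (inv g) (actV hat g v) = v"
  by (intro injD [OF hat_inj]) (simp add: hat_actV G2_inv inv_f_f bij_is_inj G2_bij)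

lemma actV_adjoint: "g \<in> G2 \<Longrightarrow> actV hat g a \<bullet> b = a \<bullet> actV hat (inv g) b"
  using actV_inner [of g a "actV hat (inv g) b"] by simp

lemma expansion: "(\<Sum>j\<in>UNIV. (v \<bullet> e j) *\<^sub>R e j) = v"
proof -
  have lin: "linear (\<lambda>v. \<Sum>j\<in>UNIV. (v \<bullet> e j) *\<^sub>R e j)"
    by (intro linearI) (simp_all add: inner_add_left scaleR_add_left sum.distrib scaleR_sum_right)
  have on_basis: "(\<Sum>j\<in>UNIV. (e i \<bullet> e j) *\<^sub>R e j) = e i" for i
    using orthonormal by (simp add: orthonormal_basis_def if_distrib [of "\<lambda>r. r *\<^sub>R _"] cong: if_cong)
  have span: "v \<in> span (range e)"
    using orthonormal by (simp add: orthonormal_basis_def)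
  have "(\<Sum>j\<in>UNIV. (v \<bullet> e j) *\<^sub>R e j) = id v"
    by (rule linear_eq_on_span [OF lin linear_id _ span]) (auto simp: on_basis)
  then show ?thesis by simp
qed

text \<open>
  A bilinear contraction does not depend on the orthonormal basis.  This is the basis independence
  of \<open>h\<close> and of traces, and it reduces sums over the unspecified basis \<open>e\<close> to sums over an adapted
  one.
\<close>

lemma contraction:
  assumes G: "bilinear G" and f: "\<And>v. (\<Sum>k\<in>I. (v \<bullet> f k) *\<^sub>R f k) = v"
  shows "(\<Sum>j\<in>UNIV. G (e j) (e j)) = (\<Sum>k\<in>I. G (f k) (f k))"
proof -
  have l: "linear (G a)" "linear (\<lambda>a. G a b)" for a b
    using G by (auto simp: bilinear_def)
  have "(\<Sum>j\<in>UNIV. G (e j) (e j)) = (\<Sum>j\<in>UNIV. G (e j) (\<Sum>k\<in>I. (e j \<bullet> f k) *\<^sub>R f k))"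
    by (simp add: f)
  also have "\<dots> = (\<Sum>j\<in>UNIV. \<Sum>k\<in>I. (e j \<bullet> f k) *\<^sub>R G (e j) (f k))"
    by (simp add: linear_sum [OF l(1)] linear_scale [OF l(1)])
  also have "\<dots> = (\<Sum>k\<in>I. \<Sum>j\<in>UNIV. (e j \<bullet> f k) *\<^sub>R G (e j) (f k))"
    by (rule sum.swap)
  also have "\<dots> = (\<Sum>k\<in>I. G (\<Sum>j\<in>UNIV. (f k \<bullet> e j) *\<^sub>R e j) (f k))"
    by (simp add: linear_sum [OF l(2)] linear_scale [OF l(2)] inner_commute)
  finally show ?thesis by (simp add: expansion)
qed

text \<open>
  An element of \<open>W\<close>, contracted with a vector by means of the metric.  In this way \<open>W\<close> becomes
  the space of linear maps from \<open>V\<close> to the octonions, on which \<open>h\<close>, right multiplication and the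
  group action have descriptions that do not mention the basis.
\<close>

definition ev :: "W \<Rightarrow> 'v \<Rightarrow> octonion" where
  "ev w v = (\<Sum>j\<in>UNIV. (v \<bullet> e j) *\<^sub>R w $ j)"

lemma ev_basis [simp]: "ev w (e j) = w $ j"
  using orthonormal by (simp add: ev_def orthonormal_basis_def if_distrib [of "\<lambda>r. r *\<^sub>R _"] cong: if_cong)

lemma ev_linear: "linear (ev w)"
  by (intro linearI) (simp_all add: ev_def inner_add_left scaleR_add_left sum.distrib scaleR_sum_right)

lemma ev_add [simp]: "ev (w + w') v = ev w v + ev w' v"
  by (simp add: ev_def scaleR_add_right sum.distrib)

lemma ev_scaleR [simp]: "ev (r *\<^sub>R w) v = r *\<^sub>R ev w v"
  by (simp add: ev_def scaleR_sum_right mult.commute)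

lemma ev_0 [simp]: "ev 0 v = 0"
  by (simp add: ev_def)

lemma ev_sum: "ev (\<Sum>i\<in>I. w i) v = (\<Sum>i\<in>I. ev (w i) v)"
  by (induction I rule: infinite_finite_induct) auto

lemma ev_eqI: "(\<And>v. ev w v = ev w' v) \<Longrightarrow> w = w'"
  by (metis ev_basis vec_eq_iff)

lemma ev_tensor [simp]: "ev (tensor e x y) v = (v \<bullet> y) *\<^sub>R x"
proof -
  have "v \<bullet> y = (\<Sum>j\<in>UNIV. (v \<bullet> e j) * (y \<bullet> e j))"
    by (subst expansion [of y, symmetric]) (simp add: inner_sum_right mult.commute)
  then show ?thesis by (simp add: ev_def tensor_def scaleR_sum_left)
qed

lemma ev_of_linear: "linear L \<Longrightarrow> ev (\<chi> j. L (e j)) v = L v"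
  by (subst (2) expansion [of v, symmetric]) (simp add: ev_def linear_sum linear_scale)

lemma ev_h: "ev (h hat e w) v = (\<Sum>j\<in>UNIV. (hat v \<odot> hat (e j)) \<odot> ev w (e j))"
proof -
  have "ev (h hat e w) v =
        (\<Sum>i\<in>UNIV. \<Sum>j\<in>UNIV. (v \<bullet> e i) *\<^sub>R ((hat (e i) \<odot> hat (e j)) \<odot> w $ j))"
    by (simp add: h_def ev_sum)
  also have "\<dots> = (\<Sum>j\<in>UNIV. \<Sum>i\<in>UNIV. (v \<bullet> e i) *\<^sub>R ((hat (e i) \<odot> hat (e j)) \<odot> w $ j))"
    by (rule sum.swap)
  also have "\<dots> = (\<Sum>j\<in>UNIV. (hat (\<Sum>i\<in>UNIV. (v \<bullet> e i) *\<^sub>R e i) \<odot> hat (e j)) \<odot> w $ j)"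
    by (simp add: linear_sum [OF hat_linear] linear_scale [OF hat_linear]
        omult_sum_left omult_simps)
  finally show ?thesis by (simp add: expansion)
qed

lemma ev_rmul: "ev (rmul e lam w) v = ev w v \<odot> lam"
  by (simp add: rmul_def ev_sum) (simp add: ev_def omult_sum_left omult_simps)

lemma ev_actW: "g \<in> G2 \<Longrightarrow> ev (actW hat e g w) v = g (ev w (actV hat (inv g) v))"
  by (simp add: actW_def ev_sum inner_commute [of v] actV_adjoint)
    (simp add: ev_def linear_sum [OF G2_linear] linear_scale [OF G2_linear] inner_commute)

lemma actW_linear: "g \<in> G2 \<Longrightarrow> linear (actW hat e g)"
  by (intro linearI ev_eqI)
    (simp_all add: ev_actW linear_add [OF G2_linear] linear_scale [OF G2_linear])

end

text \<open>
  The automorphism \<open>\<psi>\<close> moves the coordinate vector \<open>oct \<i> 0\<close> to the given unit vector, so that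
  \<open>\<psi> \<circ> oct\<close> is a system of coordinates adapted to the slice.
\<close>

locale slice = imaginary_octonions hat e
  for hat :: "'v::euclidean_space \<Rightarrow> octonion" and e :: "7 \<Rightarrow> 'v" +
  fixes u :: 'v and \<psi> :: "octonion \<Rightarrow> octonion"
  assumes psi_G2: "\<psi> \<in> G2" and psi_i: "\<psi> (oct \<i> 0) = hat u"
begin

lemma psi_inv [simp]: "\<psi> (inv \<psi> x) = x" "inv \<psi> (\<psi> x) = x"
  using G2_bij [OF psi_G2] by (simp_all add: bij_is_surj bij_is_inj surj_f_inv_f)

lemmas psi_simps = G2_mult [OF psi_G2] linear_add [OF G2_linear [OF psi_G2]]
    linear_scale [OF G2_linear [OF psi_G2]] G2_oone [OF psi_G2]
lemmas inv_psi_simps = G2_mult [OF G2_inv [OF psi_G2]] linear_add [OF G2_linear [OF G2_inv [OF psi_G2]]]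
    linear_scale [OF G2_linear [OF G2_inv [OF psi_G2]]] G2_oone [OF G2_inv [OF psi_G2]]

text \<open>
  The vector of \<open>V\<close> with component \<open>t\<close> along \<open>u\<close> and with coordinates \<open>x\<close> in
  the orthogonal complement of \<open>u\<close>, identified with the space of complex triples.
\<close>

definition pt :: "real \<Rightarrow> complex^3 \<Rightarrow> 'v" where
  "pt t x = inv hat (\<psi> (oct (Complex 0 t) x))"

lemma hat_pt: "hat (pt t x) = \<psi> (oct (Complex 0 t) x)"
  by (simp add: pt_def G2_ImO_norm psi_G2)

lemma pt_eqI: "hat v = \<psi> (oct (Complex 0 t) x) \<Longrightarrow> v = pt t x"
  by (metis pt_def inv_hat_hat)

lemma pt_cases: obtains t x where "v = pt t x"
proof -
  obtain a x where ax: "inv \<psi> (hat v) = oct a x" by (rule oct_cases)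
  have "oct a x \<in> ImO" using G2_ImO_norm [OF G2_inv [OF psi_G2] hat_ImO] ax by metis
  then have "a = Complex 0 (Im a)" by (simp add: complex_eq_iff)
  then have "hat v = \<psi> (oct (Complex 0 (Im a)) x)" using ax by (metis psi_inv(1))
  then show ?thesis using pt_eqI that by blast
qed

lemma u_pt: "u = pt 1 0"
  by (intro pt_eqI) (simp add: psi_i imaginary_unit.code [symmetric])

lemma pt_add: "pt s x + pt t y = pt (s + t) (x + y)"
  by (intro pt_eqI) (simp add: linear_add [OF hat_linear] hat_pt oct_add plus_complex.code flip: psi_simps)

lemma pt_scaleR: "r *\<^sub>R pt t x = pt (r * t) (r *\<^sub>R x)"
  by (intro pt_eqI) (simp add: linear_scale [OF hat_linear] hat_pt oct_scaleR scaleR_complex.code flip: psi_simps)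

lemma pt_0 [simp]: "pt 0 0 = 0"
  using pt_scaleR [of 0 0 0] by simp

lemma pt_inner: "pt s x \<bullet> pt t y = s * t + Re (herm x y)"
  by (simp add: hat_pt G2_inner psi_G2 inner_oct flip: hat_inner)

lemma pt_eq_iff [simp]: "pt s x = pt t y \<longleftrightarrow> s = t \<and> x = y"
  by (metis hat_pt psi_inv(2) oct_eq_iff complex.inject)

definition frame :: "nat \<Rightarrow> 'v" where
  "frame k = [pt 1 0, pt 0 (axis 1 1), pt 0 (axis 1 \<i>), pt 0 (axis 2 1), pt 0 (axis 2 \<i>),
    pt 0 (axis 3 1), pt 0 (axis 3 \<i>)] ! k"

lemma sum_frame:
  "(\<Sum>k<7. G (frame k)) = G (pt 1 0) + (\<Sum>m\<in>UNIV. G (pt 0 (axis m 1)) + G (pt 0 (axis m \<i>)))"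
  by (simp add: frame_def eval_nat_numeral lessThan_Suc sum_3 add_ac)

lemma frame_expansion: "(\<Sum>k<7. (v \<bullet> frame k) *\<^sub>R frame k) = v"
proof -
  obtain t x where v: "v = pt t x" by (rule pt_cases)
  show ?thesis
    unfolding v sum_frame [of "\<lambda>f. (pt t x \<bullet> f) *\<^sub>R f"] sum_3
    by (simp add: pt_inner pt_scaleR pt_add herm_def sum_3 axis_def vec3_eq_iff complex_eq_iff)
qed

lemma sum_basis:
  assumes "bilinear G"
  shows "(\<Sum>j\<in>UNIV. G (e j) (e j)) = G u u +
    (\<Sum>m\<in>UNIV. G (pt 0 (axis m 1)) (pt 0 (axis m 1)) + G (pt 0 (axis m \<i>)) (pt 0 (axis m \<i>)))"
  using contraction [OF assms frame_expansion] sum_frame [of "\<lambda>v. G v v"] by (simp add: u_pt)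

lemma cross_u: "crossV hat u (pt t x) = pt 0 (\<i> *s x)"
proof -
  have "hat u \<odot> hat (pt t x) + (u \<bullet> pt t x) *\<^sub>R oone =
        \<psi> (oct \<i> 0 \<odot> oct (Complex 0 t) x + t *\<^sub>R oone)"
    by (simp add: psi_simps hat_pt psi_i) (simp add: u_pt pt_inner herm_def)
  also have "oct \<i> 0 \<odot> oct (Complex 0 t) x + t *\<^sub>R oone = oct (Complex 0 0) (\<i> *s x)"
    by (simp add: oone_oct oct_mult oct_scaleR oct_add herm_def conj_cross_def vec3_eq_iff complex_eq_iff)
  finally have "hat u \<odot> hat (pt t x) + (u \<bullet> pt t x) *\<^sub>R oone = \<psi> (oct (Complex 0 0) (\<i> *s x))" .
  then show ?thesis by (simp add: crossV_def pt_def)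
qed

end

section \<open>Complex coordinates on \<open>W\<close>\<close>

definition cvec :: "complex^'n \<Rightarrow> complex^'n" where
  "cvec x = (\<chi> k. cnj (x $ k))"

definition cmat :: "complex^'n^'m \<Rightarrow> complex^'n^'m" where
  "cmat A = (\<chi> i j. cnj (A $ i $ j))"

definition dot :: "complex^'n \<Rightarrow> complex^'n \<Rightarrow> complex" where
  "dot x y = (\<Sum>k\<in>UNIV. x $ k * y $ k)"

definition adjoint_mat :: "complex^'n^'n \<Rightarrow> complex^'n^'n" where
  "adjoint_mat A = (\<chi> i j. cnj (A $ j $ i))"

definition cscale :: "complex \<Rightarrow> complex^'n^'m \<Rightarrow> complex^'n^'m" where
  "cscale z A = (\<chi> i j. z * A $ i $ j)"

text \<open>
  The antisymmetric part of a matrix as a vector, and the inverse correspondence up to the factor 2.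
\<close>

definition axial :: "complex^3^3 \<Rightarrow> complex^3" where
  "axial B = vector [B$2$3 - B$3$2, B$3$1 - B$1$3, B$1$2 - B$2$1]"

definition skew_mat :: "complex^3 \<Rightarrow> complex^3^3" where
  "skew_mat y = vector [vector [0, y$3, - y$2], vector [- y$3, 0, y$1], vector [y$2, - y$1, 0]]"

lemma mat3_eq_iff:
  "A = (B :: 'a^3^3) \<longleftrightarrow>
     A$1$1 = B$1$1 \<and> A$1$2 = B$1$2 \<and> A$1$3 = B$1$3 \<and>
     A$2$1 = B$2$1 \<and> A$2$2 = B$2$2 \<and> A$2$3 = B$2$3 \<and>
     A$3$1 = B$3$1 \<and> A$3$2 = B$3$2 \<and> A$3$3 = B$3$3"
  by (simp add: vec3_eq_iff)

lemmas coordinate_defs = cvec_def cmat_def dot_def adjoint_mat_def cscale_def axial_def skew_mat_def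
  sum_3 matrix_vector_mult_def vector_matrix_mult_def matrix_matrix_mult_def trace_def mat_def

context slice
begin

text \<open>
  A real-linear map from \<open>R \<oplus> C\<^sup>3\<close> to \<open>C \<oplus> C\<^sup>3\<close> consists of the image \<open>(c, d)\<close> of the real unit
  and of complex-linear and antilinear parts \<open>p\<close>, \<open>q\<close> with values in \<open>C\<close> and \<open>A\<close>, \<open>B\<close> with values in
  \<open>C\<^sup>3\<close>.  This is the block decomposition: \<open>c\<close> and the trace of \<open>A\<close> make up the four trivial
  summands, the rest of \<open>A\<close> the block \<open>8\<close>, the symmetric part of \<open>B\<close> the block \<open>12\<close>, and \<open>d\<close>, \<open>p\<close>, \<open>q\<close>
  and the antisymmetric part of \<open>B\<close> the block \<open>6\<close>.
\<close>

definition coords ::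
  "W \<Rightarrow> complex \<Rightarrow> complex^3 \<Rightarrow> complex^3 \<Rightarrow> complex^3 \<Rightarrow> complex^3^3 \<Rightarrow> complex^3^3 \<Rightarrow> bool" where
  "coords w c d p q A B \<longleftrightarrow> (\<forall>t x. inv \<psi> (ev w (pt t x)) =
     oct (of_real t * c + dot p x + dot q (cvec x)) (t *\<^sub>R d + A *v x + B *v cvec x))"

lemma coordsD:
  "coords w c d p q A B \<Longrightarrow> ev w (pt t x) =
     \<psi> (oct (of_real t * c + dot p x + dot q (cvec x)) (t *\<^sub>R d + A *v x + B *v cvec x))"
  unfolding coords_def by (metis psi_inv(1))

lemma coords_ex: "\<exists>c d p q A B. coords w c d p q A B"
proof -
  define L where "L v = inv \<psi> (ev w v)" for v
  have L: "linear L"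
    unfolding L_def using linear_compose [OF ev_linear G2_linear [OF G2_inv [OF psi_G2]]]
    by (simp add: o_def)
  define a where "a v = fst (fst (L v))" for v
  define y where "y v = (THE x. \<exists>a. L v = oct a x)" for v
  have Ly: "L v = oct (a v) (y v)" for v
  proof -
    obtain a' x where "L v = oct a' x" by (rule oct_cases)
    then show ?thesis by (simp add: a_def y_def) (simp add: oct_def)
  qed
  define E where "E m = pt 0 (axis m 1)" for m
  define F where "F m = pt 0 (axis m \<i>)" for m
  define p where "p = (\<chi> m. (a (E m) - \<i> * a (F m)) / 2)"
  define q where "q = (\<chi> m. (a (E m) + \<i> * a (F m)) / 2)"
  define A where "A = (\<chi> i m. (y (E m) $ i - \<i> * y (F m) $ i) / 2)"
  define B where "B = (\<chi> i m. (y (E m) $ i + \<i> * y (F m) $ i) / 2)"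
  have "coords w (a u) (y u) p q A B"
    unfolding coords_def
  proof (intro allI)
    fix t x
    have "pt t x = t *\<^sub>R u + (\<Sum>m\<in>UNIV. Re (x$m) *\<^sub>R E m + Im (x$m) *\<^sub>R F m)"
      by (simp add: u_pt E_def F_def sum_3 pt_scaleR pt_add vec3_eq_iff axis_def complex_eq_iff)
    then have "L (pt t x) = t *\<^sub>R L u + (\<Sum>m\<in>UNIV. Re (x$m) *\<^sub>R L (E m) + Im (x$m) *\<^sub>R L (F m))"
      by (simp add: linear_add [OF L] linear_sum [OF L] linear_scale [OF L])
    also have "\<dots> = oct (of_real t * a u + dot p x + dot q (cvec x)) (t *\<^sub>R y u + A *v x + B *v cvec x)"
      by (simp add: Ly oct_scaleR oct_add sum_3 p_def q_def A_def B_def coordinate_defs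
          vec3_eq_iff complex_eq_iff field_simps)
    finally show "inv \<psi> (ev w (pt t x)) = \<dots>" by (simp add: L_def)
  qed
  then show ?thesis by blast
qed

lemma coords_eqD:
  assumes "coords w c d p q A B" "coords w c' d' p' q' A' B'"
  shows "c = c' \<and> d = d' \<and> p = p' \<and> q = q' \<and> A = A' \<and> B = B'"
proof -
  have all: "oct (of_real t * c + dot p x + dot q (cvec x)) (t *\<^sub>R d + A *v x + B *v cvec x) =
     oct (of_real t * c' + dot p' x + dot q' (cvec x)) (t *\<^sub>R d' + A' *v x + B' *v cvec x)" for t x
    using assms unfolding coords_def by metis
  have "c = c' \<and> d = d'"
    using all [of 1 0] by (simp add: coordinate_defs vec3_eq_iff)
  moreover have "p $ m = p' $ m \<and> q $ m = q' $ m \<and> A $ i $ m = A' $ i $ m \<and> B $ i $ m = B' $ i $ m"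
    for i m
  proof -
    have s: "(\<Sum>k\<in>UNIV. f k * axis m r $ k) = f m * r" for f :: "3 \<Rightarrow> complex" and r
      by (simp add: axis_def if_distrib cong: if_cong)
    have s': "cvec (axis m r) = axis m (cnj r)" for r
      by (simp add: cvec_def axis_def vec_eq_iff)
    have "p$m + q$m = p'$m + q'$m" "\<i> * (p$m - q$m) = \<i> * (p'$m - q'$m)"
      using all [of 0 "axis m 1"] all [of 0 "axis m \<i>"]
      by (simp_all add: dot_def s s' algebra_simps)
    moreover have "A$i$m + B$i$m = A'$i$m + B'$i$m" "\<i> * (A$i$m - B$i$m) = \<i> * (A'$i$m - B'$i$m)"
      using all [of 0 "axis m 1"] all [of 0 "axis m \<i>"]
      by (simp_all add: vec_eq_iff matrix_vector_mult_def s s' right_diff_distrib)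
        (auto simp add: algebra_simps)
    ultimately show ?thesis by (simp add: complex_eq_iff)
  qed
  ultimately show ?thesis by (simp add: vec_eq_iff)
qed

lemma coords_cong:
  "coords w c d p q A B \<Longrightarrow> c = c' \<Longrightarrow> d = d' \<Longrightarrow> p = p' \<Longrightarrow> q = q' \<Longrightarrow> A = A' \<Longrightarrow> B = B' \<Longrightarrow>
   coords w c' d' p' q' A' B'"
  by simp

lemma coords_inj:
  assumes "coords w c d p q A B" "coords w' c d p q A B"
  shows "w = w'"
  using coordsD [OF assms(1)] coordsD [OF assms(2)] by (intro ev_eqI) (metis pt_cases)

lemma coords_0: "coords 0 0 0 0 0 0 0"
  using linear_0 [OF G2_linear [OF G2_inv [OF psi_G2]]]
  by (simp add: coords_def zero_oct coordinate_defs vec3_eq_iff)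

lemma coords_add:
  assumes "coords w c d p q A B" "coords w' c' d' p' q' A' B'"
  shows "coords (w + w') (c + c') (d + d') (p + p') (q + q') (A + A') (B + B')"
  using assms unfolding coords_def
  by (auto simp: inv_psi_simps oct_add coordinate_defs vec3_eq_iff algebra_simps)

text \<open>
  On \<open>C\<close> right multiplication by \<open>z\<close> is multiplication by \<open>z\<close>, on its orthogonal complement it is
  multiplication by the conjugate of \<open>z\<close>.
\<close>

lemma coords_rmul:
  assumes "coords w c d p q A B" and z_def: "z = Complex \<mu> Q"
  shows "coords (rmul e (slice_point hat u \<mu> Q) w)
     (z * c) (cnj z *s d) (z *s p) (z *s q) (cscale (cnj z) A) (cscale (cnj z) B)"
proof -
  have "inv \<psi> (slice_point hat u \<mu> Q) = oct z 0"
    by (simp add: slice_point_def inv_psi_simps flip: psi_i)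
      (simp add: oone_oct oct_scaleR oct_add z_def complex_eq_iff)
  then show ?thesis
    using assms(1) unfolding coords_def
    by (simp add: ev_rmul inv_psi_simps oct_mult)
      (simp add: coordinate_defs herm_def conj_cross_def vec3_eq_iff algebra_simps scaleR_conv_of_real)
qed

text \<open>
  The whole computation of \<open>h\<close>.  The formulas are antilinear up to a real multiple of each
  coordinate, and visibly respect the blocks.
\<close>

lemma coords_h:
  assumes "coords w c d p q A B"
  shows "coords (h hat e w)
     (- c - 2 * \<i> * cnj (trace A))
     (- d + (2 * \<i>) *s cvec p + (2 * \<i>) *s cvec (axial B))
     (\<i> *s cvec d - 2 *s p)
     (2 *s cvec (axial B))
     (cscale 2 (adjoint_mat A - A) - mat (2 * cnj (trace A) + \<i> * cnj c))
     (skew_mat (\<i> *s cvec d + 2 *s cvec q))"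
  unfolding coords_def
proof (intro allI)
  fix t x
  define G where "G a b = (hat (pt t x) \<odot> hat a) \<odot> ev w b" for a b
  have G: "bilinear G"
    unfolding bilinear_def G_def
    by (auto intro!: linearI simp: linear_add [OF hat_linear] linear_scale [OF hat_linear]
        linear_add [OF ev_linear] linear_scale [OF ev_linear] omult_simps)
  have g: "inv \<psi> (G a b) = (oct (Complex 0 t) x \<odot> inv \<psi> (hat a)) \<odot> inv \<psi> (ev w b)" for a b
    by (simp add: G_def inv_psi_simps hat_pt)
  have "inv \<psi> (ev (h hat e w) (pt t x)) = inv \<psi> (\<Sum>j\<in>UNIV. G (e j) (e j))"
    by (simp add: ev_h G_def)
  also have "\<dots> = inv \<psi> (G u u) + (\<Sum>m\<in>UNIV. inv \<psi> (G (pt 0 (axis m 1)) (pt 0 (axis m 1))) +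
      inv \<psi> (G (pt 0 (axis m \<i>)) (pt 0 (axis m \<i>))))"
    by (simp add: sum_basis [OF G] inv_psi_simps sum_3)
  also have "\<dots> = oct
       (of_real t * (- c - 2 * \<i> * cnj (trace A)) + dot (\<i> *s cvec d - 2 *s p) x +
        dot (2 *s cvec (axial B)) (cvec x))
       (t *\<^sub>R (- d + (2 * \<i>) *s cvec p + (2 * \<i>) *s cvec (axial B)) +
        (cscale 2 (adjoint_mat A - A) - mat (2 * cnj (trace A) + \<i> * cnj c)) *v x +
        skew_mat (\<i> *s cvec d + 2 *s cvec q) *v cvec x)"
    unfolding u_pt g hat_pt psi_inv assms [unfolded coords_def, rule_format]
    by (simp add: oct_mult oct_add sum_3 herm_def conj_cross_def axis_def coordinate_defs vec3_eq_iff)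
      (simp add: complex_eq_iff algebra_simps)
  finally show "inv \<psi> (ev (h hat e w) (pt t x)) = \<dots>" .
qed

lemma eigen_iff:
  assumes "coords w c d p q A B" and z_def: "z = Complex \<mu> Q"
  shows "h hat e w = rmul e (slice_point hat u \<mu> Q) w \<longleftrightarrow>
    z * c = - c - 2 * \<i> * cnj (trace A) \<and>
    cnj z *s d = - d + (2 * \<i>) *s cvec p + (2 * \<i>) *s cvec (axial B) \<and>
    z *s p = \<i> *s cvec d - 2 *s p \<and>
    z *s q = 2 *s cvec (axial B) \<and>
    cscale (cnj z) A = cscale 2 (adjoint_mat A - A) - mat (2 * cnj (trace A) + \<i> * cnj c) \<and>
    cscale (cnj z) B = skew_mat (\<i> *s cvec d + 2 *s cvec q)" (is "_ \<longleftrightarrow> ?R")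
proof
  assume eq: "h hat e w = rmul e (slice_point hat u \<mu> Q) w"
  show ?R
    using coords_eqD [OF coords_h [OF assms(1)] coords_rmul [OF assms, folded eq]]
    unfolding z_def by metis
next
  assume ?R
  then show "h hat e w = rmul e (slice_point hat u \<mu> Q) w"
    using coords_h [OF assms(1)] coords_rmul [OF assms]
    by (metis coords_inj)
qed

end

section \<open>The eigenvalue equation on the blocks\<close>

text \<open>
  This is the reason why the loci of the blocks \<open>1\<close> and \<open>8\<close> are curves in the real plane: on these
  blocks the eigenvalue equation reduces to an equation between a complex number and its conjugate,
  and the condition for solvability is real.
\<close>

lemma antilinear_solvable:
  fixes a b :: complex
  shows "(\<exists>c. c \<noteq> 0 \<and> a * c = b * cnj c) \<longleftrightarrow> cmod a = cmod b"
proof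
  assume "\<exists>c. c \<noteq> 0 \<and> a * c = b * cnj c"
  then obtain c where "c \<noteq> 0" "a * c = b * cnj c" by blast
  then show "cmod a = cmod b"
    by (metis complex_mod_cnj mult_cancel_right norm_eq_zero norm_mult)
next
  assume ab: "cmod a = cmod b"
  show "\<exists>c. c \<noteq> 0 \<and> a * c = b * cnj c"
  proof (cases "a = 0")
    case True
    then show ?thesis using ab by (intro exI [of _ 1]) auto
  next
    case False
    define c where "c = csqrt (b / a)"
    have cc: "c * c = b / a" by (simp add: c_def flip: power2_eq_square)
    have "cmod c * cmod c = 1"
      using ab False by (auto simp: cc norm_divide simp flip: norm_mult)
    then have n: "cmod c = 1"
      by (metis abs_norm_cancel abs_square_eq_1 power2_eq_square)
    then have "c * cnj c = 1" by (simp add: complex_norm_square [symmetric])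
    then have "a * c = a * (c * c) * cnj c" by (simp add: mult.assoc)
    also have "\<dots> = b * cnj c" using False by (simp add: cc)
    finally show ?thesis using n by (intro exI [of _ c]) auto
  qed
qed

text \<open>
  The quartic in the form \<open>\<bar>z - 1\<bar>\<^sup>2 \<bar>z + 4\<bar>\<^sup>2 = 16 \<bar>z + 1\<bar>\<^sup>2\<close> with \<open>z = \<mu> + \<i> Q\<close>, in which it arises.  The
  conjugate on the right-hand side is the coefficient in the equation for \<open>c\<close>.
\<close>

lemma quartic_iff:
  "(\<mu>, Q) \<in> quartic \<longleftrightarrow> cmod (Complex \<mu> Q ^ 2 + 3 * Complex \<mu> Q - 4) = cmod (4 * (1 + cnj (Complex \<mu> Q)))"
proof -
  have "cmod (Complex \<mu> Q ^ 2 + 3 * Complex \<mu> Q - 4) = cmod (4 * (1 + cnj (Complex \<mu> Q))) \<longleftrightarrow>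
     (cmod (Complex \<mu> Q ^ 2 + 3 * Complex \<mu> Q - 4))\<^sup>2 = (cmod (4 * (1 + cnj (Complex \<mu> Q))))\<^sup>2"
    by simp
  also have "\<dots> \<longleftrightarrow> (\<mu>, Q) \<in> quartic"
    unfolding cmod_power2 quartic_def
    by (simp add: power2_eq_square power3_eq_cube power4_eq_xxxx algebra_simps)
  finally show ?thesis by simp
qed

lemma circle_iff: "(\<mu>, Q) \<in> circle \<longleftrightarrow> cmod (2 + cnj (Complex \<mu> Q)) = 2"
proof -
  have "cmod (2 + cnj (Complex \<mu> Q)) = 2 \<longleftrightarrow> (cmod (2 + cnj (Complex \<mu> Q)))\<^sup>2 = 2\<^sup>2"
    by (subst power2_eq_iff_nonneg) auto
  then show ?thesis
    unfolding cmod_power2 circle_def by (simp add: add.commute)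
qed

text \<open>
  The system of the invariants, with \<open>T\<close> the trace of \<open>A\<close>.  The first equation expresses \<open>T\<close> by
  \<open>c\<close>, and the second then becomes an antilinear equation for \<open>c\<close>.
\<close>

lemma trivial_block_quartic:
  assumes c: "z * c = - c - 2 * \<i> * cnj T" and T: "cnj z * T = - 2 * T - 4 * cnj T - 3 * \<i> * cnj c"
    and z: "z = Complex \<mu> Q" and "c \<noteq> 0 \<or> T \<noteq> 0"
  shows "(\<mu>, Q) \<in> quartic"
proof -
  have T_c: "cnj T = \<i> / 2 * ((1 + z) * c)"
    using c by (simp add: algebra_simps complex_eq_iff)
  then have T_c': "T = - \<i> / 2 * ((1 + cnj z) * cnj c)"
    by (metis complex_cnj_cnj complex_cnj_mult complex_cnj_divide complex_cnj_i complex_cnj_numeral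
        complex_cnj_add complex_cnj_one)
  have "c \<noteq> 0" using T_c' assms(4) by auto
  have "\<i> / 2 * ((z ^ 2 + 3 * z - 4) * c - 4 * (1 + cnj z) * cnj c) =
      z * cnj T - (- 2 * cnj T - 4 * T + 3 * \<i> * c)"
    unfolding T_c by (subst T_c') (simp add: field_simps power2_eq_square)
  also have "\<dots> = 0"
    using arg_cong [OF T, of cnj] by simp
  finally have "(z ^ 2 + 3 * z - 4) * c = 4 * (1 + cnj z) * cnj c"
    by simp
  with \<open>c \<noteq> 0\<close> show ?thesis
    unfolding quartic_iff z by (metis antilinear_solvable)
qed

lemma trivial_block_solution:
  assumes "(\<mu>, Q) \<in> quartic" and z: "z = Complex \<mu> Q"
  obtains c a where "c \<noteq> 0" "z * c = - c - 6 * \<i> * cnj a"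
    "cnj z * a = - 2 * a - 4 * cnj a - \<i> * cnj c"
proof -
  obtain c where c: "c \<noteq> 0" "(z ^ 2 + 3 * z - 4) * c = 4 * (1 + cnj z) * cnj c"
    using assms unfolding quartic_iff by (metis antilinear_solvable)
  define a where "a = - \<i> / 6 * ((1 + cnj z) * cnj c)"
  have "z * c = - c - 6 * \<i> * cnj a"
    by (simp add: a_def algebra_simps)
  moreover have "cnj z * a = - 2 * a - 4 * cnj a - \<i> * cnj c"
  proof -
    have "cnj z * a - (- 2 * a - 4 * cnj a - \<i> * cnj c) =
        - \<i> / 6 * ((cnj z ^ 2 + 3 * cnj z - 4) * cnj c - 4 * (1 + z) * c)"
      by (simp add: a_def field_simps power2_eq_square)
    also have "\<dots> = 0" using arg_cong [OF c(2), of cnj] by simp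
    finally show ?thesis by simp
  qed
  ultimately show ?thesis using that c(1) by blast
qed

text \<open>
  The system of the block \<open>6\<close> is the same for each of the three coordinates; \<open>b\<close> is a coordinate
  of the antisymmetric part of \<open>B\<close>.  After conjugation of \<open>p\<close> and \<open>b\<close> it is complex-linear, and its
  determinant is a polynomial in \<open>z\<close> and its conjugate whose real and imaginary parts vanish together only
  for \<open>Q = 0\<close>.
\<close>

lemma six_block_real:
  assumes d: "cnj z * d = - d + 2 * \<i> * cnj p + 2 * \<i> * cnj b"
    and p: "z * p = \<i> * cnj d - 2 * p"
    and q: "z * q = 2 * cnj b"
    and b: "cnj z * b = 2 * \<i> * cnj d + 4 * cnj q"
    and z: "z = Complex \<mu> Q"
    and nz: "d \<noteq> 0 \<or> p \<noteq> 0 \<or> q \<noteq> 0 \<or> b \<noteq> 0"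
  shows "Q = 0 \<and> \<mu> * (\<mu> + 4) * (\<mu>\<^sup>2 - \<mu> - 8) = 0"
proof -
  define P where "P = cnj p"
  define T where "T = cnj b"
  have P: "(2 + cnj z) * P = - \<i> * d"
    using arg_cong [OF p, of cnj] by (simp add: P_def algebra_simps)
  have T: "z * T = - 2 * \<i> * d + 4 * q"
    using arg_cong [OF b, of cnj] by (simp add: T_def algebra_simps)
  have qT: "z * q = 2 * T" using q by (simp add: T_def)
  have d': "(1 + cnj z) * d = 2 * \<i> * P + 2 * \<i> * T"
    using d by (simp add: P_def T_def algebra_simps)
  have "d \<noteq> 0"
  proof
    assume 0: "d = 0"
    then have "P = - T" using d' by (simp add: complex_eq_iff)
    have "T = 0"
    proof (rule ccontr)
      assume "T \<noteq> 0"
      then have "2 + cnj z = 0" using P 0 \<open>P = - T\<close> by simp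
      then have "z = - 2" by (simp add: complex_eq_iff)
      then show False using T qT 0 \<open>T \<noteq> 0\<close> by (simp add: complex_eq_iff)
    qed
    then show False using nz 0 \<open>P = - T\<close> T by (auto simp: P_def T_def)
  qed
  have T': "(8 - z\<^sup>2) * T = 2 * \<i> * z * d"
  proof -
    have "z * (z * T) = - 2 * \<i> * z * d + 4 * (z * q)" unfolding T by (simp add: algebra_simps)
    then show ?thesis unfolding qT by (simp add: algebra_simps power2_eq_square)
  qed
  have "((1 + cnj z) * d) * ((2 + cnj z) * (8 - z\<^sup>2)) =
      2 * \<i> * (8 - z\<^sup>2) * ((2 + cnj z) * P) + 2 * \<i> * (2 + cnj z) * ((8 - z\<^sup>2) * T)"
    unfolding d' by (simp add: algebra_simps)
  also have "\<dots> = (2 * (8 - z\<^sup>2) - 4 * (2 + cnj z) * z) * d"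
    unfolding P T' by (simp add: complex_eq_iff algebra_simps)
  finally have "((1 + cnj z) * (2 + cnj z) * (8 - z\<^sup>2) - 2 * (8 - z\<^sup>2) + 4 * (2 + cnj z) * z) * d = 0"
    by (simp add: algebra_simps)
  then have poly: "(1 + cnj z) * (2 + cnj z) * (8 - z\<^sup>2) - 2 * (8 - z\<^sup>2) + 4 * (2 + cnj z) * z = 0"
    using \<open>d \<noteq> 0\<close> by simp
  define N where "N = \<mu>\<^sup>2 + Q\<^sup>2"
  \<comment> \<open>if \<open>Q\<close> were not 0, the imaginary part would express \<open>\<mu>\<close> by \<open>N = \<bar>z\<bar>\<^sup>2\<close>; the real part then leaves only \<open>N = 16\<close>, \<open>\<mu> = - 4\<close>, whence \<open>Q = 0\<close>\<close>
  have im: "Q * (16 * \<mu> + 16 + 3 * N) = 0"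
    using arg_cong [OF poly, of Im] by (simp add: z N_def power2_eq_square algebra_simps)
  have re: "- 8 * (2 * \<mu>\<^sup>2 - N) + N\<^sup>2 - 32 * \<mu> + 3 * N * \<mu> - 4 * N = 0"
    using arg_cong [OF poly, of Re] by (simp add: z N_def power2_eq_square algebra_simps)
  have "Q = 0"
  proof (rule ccontr)
    assume "Q \<noteq> 0"
    then have mu: "\<mu> = - 1 - 3 * N / 16" using im by simp
    then have "(N - 16) * (N + 8) = 0"
      using re unfolding mu by (simp add: power2_eq_square field_simps)
    moreover have "N \<ge> 0" by (simp add: N_def)
    ultimately have "N = 16" by simp
    then have "\<mu> = - 4" using mu by simp
    moreover have "\<mu>\<^sup>2 + Q\<^sup>2 = 16" using \<open>N = 16\<close> unfolding N_def .
    ultimately show False using \<open>Q \<noteq> 0\<close> by simp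
  qed
  then show ?thesis
    using re by (simp add: N_def power2_eq_square algebra_simps)
qed

context slice
begin

lemma trace_cscale: "trace (cscale z A) = z * trace A"
  by (simp add: trace_def cscale_def sum_distrib_left)

lemma trace_adjoint: "trace (adjoint_mat A) = cnj (trace A)"
  by (simp add: trace_def adjoint_mat_def)

lemma trace_scalar: "trace (mat a :: complex^3^3) = 3 * a"
  by (simp add: trace_def mat_def sum_3)

lemma eigen_invariants:
  assumes w: "coords w c d p q A B" and h: "h hat e w = rmul e (slice_point hat u \<mu> Q) w"
    and "(\<mu>, Q) \<notin> quartic"
  shows "c = 0 \<and> trace A = 0"
proof -
  note eq = h [unfolded eigen_iff [OF w refl]]
  have "trace (cscale (cnj (Complex \<mu> Q)) A) =
      trace (cscale 2 (adjoint_mat A - A) - mat (2 * cnj (trace A) + \<i> * cnj c))"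
    using eq by metis
  then have "cnj (Complex \<mu> Q) * trace A = - 2 * trace A - 4 * cnj (trace A) - 3 * \<i> * cnj c"
    by (simp add: trace_cscale trace_adjoint trace_scalar trace_sub)
  then show ?thesis using trivial_block_quartic eq assms(3) by blast
qed

text \<open>
  The traceless part of \<open>A\<close> satisfies \<open>(2 + cnj z) A = 2 A\<^sup>*\<close>.  Comparing the absolute values of
  an entry and of its transpose gives \<open>\<bar>2 + z\<bar> = 2\<close>.
\<close>

lemma eigen_adjoint:
  assumes w: "coords w 0 d p q A B" and "trace A = 0"
    and h: "h hat e w = rmul e (slice_point hat u \<mu> Q) w"
    and "(\<mu>, Q) \<notin> circle"
  shows "A = 0"
proof -
  let ?z = "cnj (Complex \<mu> Q)"
  have "cscale ?z A = cscale 2 (adjoint_mat A - A)"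
    using h [unfolded eigen_iff [OF w refl]] assms(2) by (simp add: mat_0)
  then have "?z * A $ i $ j = 2 * (cnj (A $ j $ i) - A $ i $ j)" for i j
    by (simp add: cscale_def adjoint_mat_def vec_eq_iff)
  then have eq: "(2 + ?z) * A $ i $ j = 2 * cnj (A $ j $ i)" for i j
    by (simp add: algebra_simps)
  have n: "cmod (2 + ?z) * cmod (A $ i $ j) = 2 * cmod (A $ j $ i)" for i j
    using arg_cong [OF eq [of i j], of cmod] by (simp only: norm_mult) simp
  have "A $ i $ j = 0" for i j
  proof (rule ccontr)
    assume "A $ i $ j \<noteq> 0"
    have "cmod (2 + ?z) * (cmod (2 + ?z) * cmod (A $ i $ j)) = 2 * (cmod (2 + ?z) * cmod (A $ j $ i))"
      unfolding n [of i j] by (rule mult.left_commute)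
    also have "\<dots> = 2 * (2 * cmod (A $ i $ j))"
      unfolding n [of j i] ..
    finally have "cmod (2 + ?z) * (cmod (2 + ?z) * cmod (A $ i $ j)) = 2 * (2 * cmod (A $ i $ j))" .
    then have "cmod (2 + ?z) * cmod (2 + ?z) = 2 * 2" using \<open>A $ i $ j \<noteq> 0\<close> by simp
    then have "cmod (2 + ?z) = 2"
      by (metis abs_numeral abs_norm_cancel abs_mult_self_eq power2_eq_iff_nonneg power2_eq_square norm_ge_zero zero_le_numeral)
    with assms(4) show False by (simp add: circle_iff)
  qed
  then show ?thesis by (simp add: vec_eq_iff)
qed

text \<open>
  If only the blocks \<open>6\<close> and \<open>12\<close> are involved, the eigenvalue is real.  It is a root of the
  determinant of the block \<open>6\<close>, or it is 0, the eigenvalue of \<open>h\<close> on the block \<open>12\<close>.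
\<close>

lemma eigen_moving:
  assumes w: "coords w 0 d p q 0 B" and h: "h hat e w = rmul e (slice_point hat u \<mu> Q) w"
    and "w \<noteq> 0"
  shows "Q = 0 \<and> \<mu> * (\<mu> + 4) * (\<mu>\<^sup>2 - \<mu> - 8) = 0"
proof (cases "d = 0 \<and> p = 0 \<and> q = 0 \<and> axial B = 0")
  case False
  let ?z = "Complex \<mu> Q"
  note eq = h [unfolded eigen_iff [OF w refl]]
  obtain k where k: "d $ k \<noteq> 0 \<or> p $ k \<noteq> 0 \<or> q $ k \<noteq> 0 \<or> axial B $ k \<noteq> 0"
    using False by (auto simp: vec_eq_iff)
  have "cscale (cnj ?z) B = skew_mat (\<i> *s cvec d + 2 *s cvec q)" using eq by blast
  then have "axial (cscale (cnj ?z) B) $ k = axial (skew_mat (\<i> *s cvec d + 2 *s cvec q)) $ k"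
    by simp
  then have "cnj ?z * axial B $ k = 2 * \<i> * cnj (d $ k) + 4 * cnj (q $ k)"
    using exhaust_3 [of k] by (auto simp: axial_def skew_mat_def cscale_def cvec_def algebra_simps)
  moreover have "cnj ?z * d $ k = - d $ k + 2 * \<i> * cnj (p $ k) + 2 * \<i> * cnj (axial B $ k)"
    "?z * p $ k = \<i> * cnj (d $ k) - 2 * p $ k" "?z * q $ k = 2 * cnj (axial B $ k)"
    using eq by (simp_all add: vec_eq_iff cvec_def)
  ultimately show ?thesis using six_block_real [OF _ _ _ _ refl k] by blast
next
  case True
  have "cscale (cnj (Complex \<mu> Q)) B = skew_mat (\<i> *s cvec d + 2 *s cvec q)"
    using h [unfolded eigen_iff [OF w refl]] by blast
  with True have "cnj (Complex \<mu> Q) = 0 \<or> B $ i $ j = 0" for i j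
    using exhaust_3 [of i] exhaust_3 [of j]
    by (auto simp: cscale_def skew_mat_def cvec_def mat3_eq_iff)
  moreover have "B \<noteq> 0" using w True coords_inj [OF _ coords_0] \<open>w \<noteq> 0\<close> by blast
  ultimately have "cnj (Complex \<mu> Q) = 0"
    by (metis vec_eq_iff zero_index)
  then show ?thesis by (simp add: complex_eq_iff)
qed

text \<open>
  The real eigenvalues of the blocks \<open>6\<close> and \<open>12\<close> give nothing new: 0 and \<open>- 4\<close> lie on the
  circle, and the roots of \<open>\<mu>\<^sup>2 - \<mu> - 8\<close> on the quartic, which for \<open>Q = 0\<close> is
  \<open>\<mu> (\<mu> + 7) (\<mu>\<^sup>2 - \<mu> - 8)\<close>.
\<close>

lemma eigen_locus:
  assumes h: "h hat e w = rmul e (slice_point hat u \<mu> Q) w" and "w \<noteq> 0"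
  shows "(\<mu>, Q) \<in> quartic \<or> (\<mu>, Q) \<in> circle"
proof (rule ccontr)
  assume no: "\<not> ?thesis"
  obtain c d p q A B where w: "coords w c d p q A B" using coords_ex by blast
  have "c = 0" "trace A = 0" using eigen_invariants [OF w h] no by auto
  moreover from this have "A = 0" using eigen_adjoint [of w d p q A B] w h no by auto
  ultimately have "Q = 0 \<and> \<mu> * (\<mu> + 4) * (\<mu>\<^sup>2 - \<mu> - 8) = 0"
    using eigen_moving [OF _ h \<open>w \<noteq> 0\<close>] w by blast
  moreover from this have "\<mu> ^ 4 + 6 * \<mu> ^ 3 - 15 * \<mu>\<^sup>2 - 56 * \<mu> = 0 \<or> \<mu> + 4 = 0"
  proof -
    have "\<mu> ^ 4 + 6 * \<mu> ^ 3 - 15 * \<mu>\<^sup>2 - 56 * \<mu> = (\<mu> + 7) * (\<mu> * (\<mu>\<^sup>2 - \<mu> - 8))"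
      by (simp add: power2_eq_square power3_eq_cube power4_eq_xxxx algebra_simps)
    then show ?thesis using \<open>Q = 0 \<and> _\<close> by auto
  qed
  ultimately show False using no by (auto simp: quartic_def circle_def eq_neg_iff_add_eq_0 [symmetric])
qed

lemma quartic_eigenvector:
  assumes "(\<mu>, Q) \<in> quartic"
  obtains c a where "c \<noteq> 0"
    "\<And>w. coords w c 0 0 0 (mat a) 0 \<Longrightarrow> h hat e w = rmul e (slice_point hat u \<mu> Q) w"
proof -
  obtain c a where ca: "c \<noteq> 0" "Complex \<mu> Q * c = - c - 6 * \<i> * cnj a"
    "cnj (Complex \<mu> Q) * a = - 2 * a - 4 * cnj a - \<i> * cnj c"
    using trivial_block_solution [OF assms refl] by blast
  have "h hat e w = rmul e (slice_point hat u \<mu> Q) w" if w: "coords w c 0 0 0 (mat a) 0" for w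
    unfolding eigen_iff [OF w refl]
    by (simp add: trace_scalar ca) (simp add: coordinate_defs vec3_eq_iff ca)
  then show ?thesis using that ca(1) by blast
qed

text \<open>
  For a skew-hermitian matrix \<open>K\<close> the equation \<open>(2 + cnj z) A = 2 A\<^sup>*\<close> for \<open>A = r K\<close> is the scalar
  equation \<open>(2 + cnj z) r = - 2 cnj r\<close>.
\<close>

lemma circle_eigenvector:
  assumes "(\<mu>, Q) \<in> circle"
  obtains r where "r \<noteq> 0"
    "\<And>w K. coords w 0 0 0 0 (cscale r K) 0 \<Longrightarrow> adjoint_mat K = - K \<Longrightarrow> trace K = 0 \<Longrightarrow>
      h hat e w = rmul e (slice_point hat u \<mu> Q) w"
proof -
  obtain r where r: "r \<noteq> 0" "(2 + cnj (Complex \<mu> Q)) * r = - 2 * cnj r"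
    using assms unfolding circle_iff by (metis antilinear_solvable norm_minus_cancel norm_numeral)
  have "h hat e w = rmul e (slice_point hat u \<mu> Q) w"
    if w: "coords w 0 0 0 0 (cscale r K) 0" and K: "adjoint_mat K = - K" "trace K = 0" for w K
  proof -
    have tr: "trace (cscale r K) = 0"
      using K(2) by (simp add: trace_cscale)
    have zr: "cnj (Complex \<mu> Q) * r = - 2 * cnj r - 2 * r"
      using r(2) by (simp add: algebra_simps)
    have "cnj (Complex \<mu> Q) * (r * K$i$j) = 2 * (cnj r * cnj (K$j$i) - r * K$i$j)" for i j
    proof -
      have "cnj (K$j$i) = - K$i$j" using K(1) by (simp add: adjoint_mat_def vec_eq_iff)
      then show ?thesis using zr by (simp flip: mult.assoc) (simp add: algebra_simps)
    qed
    then have "cscale (cnj (Complex \<mu> Q)) (cscale r K) = cscale 2 (adjoint_mat (cscale r K) - cscale r K)"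
      by (simp add: cscale_def adjoint_mat_def vec_eq_iff)
    then show ?thesis
      unfolding eigen_iff [OF w refl]
      by (simp add: tr mat_0) (simp add: coordinate_defs vec3_eq_iff)
  qed
  then show ?thesis using that r(1) by blast
qed

end

section \<open>Some elements of the stabilizer\<close>

text \<open>
  The action of a matrix on the second summand of \<open>C \<oplus> C\<^sup>3\<close>.
\<close>

definition rot :: "complex^3^3 \<Rightarrow> octonion \<Rightarrow> octonion" where
  "rot M w = oct (fst (fst w)) (M *v vector [snd (fst w), fst (snd w), cnj (snd (snd w))])"

lemma rot_oct [simp]: "rot M (oct a x) = oct a (M *v x)"
proof -
  have "vector [x $ 1, x $ 2, x $ 3] = x" by (simp add: vec3_eq_iff)
  then show ?thesis by (simp add: rot_def oct_def)
qed

text \<open>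
  Two mutually inverse matrices in \<open>SU(3)\<close>.  That the determinant is 1 is expressed by
  compatibility with the conjugated cross product, since this is what makes \<open>rot\<close> an automorphism.
\<close>

definition SU_pair :: "complex^3^3 \<Rightarrow> complex^3^3 \<Rightarrow> bool" where
  "SU_pair M N \<longleftrightarrow> M ** N = mat 1 \<and> N ** M = mat 1 \<and>
     (\<forall>x y. herm (M *v x) (M *v y) = herm x y) \<and>
     (\<forall>x y. conj_cross (M *v x) (M *v y) = M *v conj_cross x y)"

lemma SU_pair_cancel:
  assumes "SU_pair M N"
  shows "M *v (N *v x) = x" "N *v (M *v x) = x"
  using assms by (simp_all add: SU_pair_def matrix_vector_mul_assoc)

lemma vector_scalar_mult_matrix: "M *v (a *s x) = a *s (M *v (x :: complex^3))"
  by (simp add: vec_eq_iff matrix_vector_mult_def sum_distrib_left mult.left_commute)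

lemma rot_G2:
  assumes "SU_pair M N" shows "rot M \<in> G2"
proof -
  have "linear (rot M)"
  proof (rule linearI)
    fix x y :: octonion and r :: real
    obtain a b v w where [simp]: "x = oct a v" "y = oct b w" by (metis oct_cases)
    show "rot M (x + y) = rot M x + rot M y"
      by (simp add: oct_add matrix_vector_right_distrib)
    show "rot M (r *\<^sub>R x) = r *\<^sub>R rot M x"
      by (simp add: oct_scaleR) (simp add: vec_eq_iff matrix_vector_mult_def scaleR_sum_right)
  qed
  moreover have "rot M (rot N x) = x" "rot N (rot M x) = x" for x
    by (metis assms SU_pair_cancel oct_cases rot_oct)+
  then have "bij (rot M)" by (metis bijI')
  moreover have "rot M (x \<odot> y) = rot M x \<odot> rot M y" for x y
  proof -
    obtain a b v w where [simp]: "x = oct a v" "y = oct b w" by (metis oct_cases)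
    show ?thesis
      using assms by (simp add: oct_mult SU_pair_def matrix_vector_right_distrib vector_scalar_mult_matrix)
  qed
  ultimately show ?thesis unfolding G2_def by blast
qed

definition \<omega> :: complex where "\<omega> = Complex (- 1 / 2) (sqrt 3 / 2)"

lemma omega_square: "\<omega> * \<omega> = cnj \<omega>" and omega_cnj: "\<omega> * cnj \<omega> = 1"
  and omega_sum: "1 + \<omega> + cnj \<omega> = 0" and omega_neq_1: "\<omega> \<noteq> 1" "cnj \<omega> \<noteq> 1"
  by (simp_all add: \<omega>_def complex_eq_iff)

text \<open>
  The diagonal sign matrices and the cyclic permutation matrix generate a tetrahedral group, of
  order 12, in \<open>SO(3)\<close>.  It has no fixed vectors in \<open>su(3)\<close>, so the sum of its elements separates the
  block \<open>8\<close> from the trivial block.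
\<close>

definition sign1 :: "complex^3^3" where
  "sign1 = vector [vector [1, 0, 0], vector [0, -1, 0], vector [0, 0, -1]]"

definition sign2 :: "complex^3^3" where
  "sign2 = vector [vector [-1, 0, 0], vector [0, 1, 0], vector [0, 0, -1]]"

definition cyc :: "complex^3^3" where
  "cyc = vector [vector [0, 0, 1], vector [1, 0, 0], vector [0, 1, 0]]"

lemma SU_pair_center: "SU_pair (mat \<omega>) (mat (cnj \<omega>))"
proof -
  have m: "mat \<omega> *v x = \<omega> *s x" for x :: "complex^3"
    by (simp add: coordinate_defs vec3_eq_iff)
  have a: "\<omega> * y * (cnj \<omega> * z) = y * z" "\<omega> * y * (\<omega> * z) = cnj \<omega> * (y * z)"
      "cnj \<omega> * y * (cnj \<omega> * z) = \<omega> * (y * z)" for y z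
  proof -
    have "\<omega> * y * (cnj \<omega> * z) = (\<omega> * cnj \<omega>) * (y * z)"
      "\<omega> * y * (\<omega> * z) = (\<omega> * \<omega>) * (y * z)"
      "cnj \<omega> * y * (cnj \<omega> * z) = cnj (\<omega> * \<omega>) * (y * z)" by (simp_all add: mult_ac)
    then show "\<omega> * y * (cnj \<omega> * z) = y * z" "\<omega> * y * (\<omega> * z) = cnj \<omega> * (y * z)"
      "cnj \<omega> * y * (cnj \<omega> * z) = \<omega> * (y * z)"
      by (simp_all only: omega_cnj omega_square complex_cnj_cnj mult_1)
  qed
  have "(mat \<omega> :: complex^3^3) ** mat (cnj \<omega>) = mat 1" "(mat (cnj \<omega>) :: complex^3^3) ** mat \<omega> = mat 1"
    by (simp_all add: coordinate_defs vec3_eq_iff omega_cnj mult.commute [of "cnj \<omega>"])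
  then show ?thesis
    unfolding SU_pair_def m
    by (simp add: herm_def sum_3 conj_cross_def vec3_eq_iff a) (simp add: algebra_simps)
qed

lemma SU_pair_signs: "SU_pair sign1 sign1" "SU_pair sign2 sign2"
  by (simp_all add: SU_pair_def sign1_def sign2_def coordinate_defs herm_def conj_cross_def vec3_eq_iff
      algebra_simps)

lemma SU_pair_cyc: "SU_pair cyc (transpose cyc)"
  by (simp add: SU_pair_def cyc_def coordinate_defs transpose_def herm_def conj_cross_def vec3_eq_iff)

text \<open>
  Conjugating by the signs and adding up removes the off-diagonal entries, and the cyclic
  permutations then replace the diagonal by its sum.
\<close>

lemma group_sum_matrix:
  fixes K :: "complex^3^3"
  defines "K1 \<equiv> K + sign1 ** K ** sign1"
  defines "K2 \<equiv> K1 + sign2 ** K1 ** sign2"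
  shows "K2 + cyc ** K2 ** transpose cyc + cyc ** (cyc ** K2 ** transpose cyc) ** transpose cyc =
     mat (4 * trace K)"
  unfolding K2_def K1_def
  by (simp add: sign1_def sign2_def cyc_def coordinate_defs transpose_def vec3_eq_iff)

text \<open>
  Two elements of the group ring.  They commute with every isomorphism of modules, so that an identity such as \<open>tri act g x = 0\<close> can be carried over from the
  model of a representation to its copies in \<open>W\<close>.
\<close>

definition dup :: "('g \<Rightarrow> 'a \<Rightarrow> 'a) \<Rightarrow> 'g \<Rightarrow> 'a \<Rightarrow> 'a::real_vector" where
  "dup act g x = x + act g x"

definition tri :: "('g \<Rightarrow> 'a \<Rightarrow> 'a) \<Rightarrow> 'g \<Rightarrow> 'a \<Rightarrow> 'a::real_vector" where
  "tri act g x = x + act g x + act g (act g x)"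

lemma submodule_dup_tri:
  assumes "submodule G act U" "g \<in> G" "x \<in> U"
  shows "dup act g x \<in> U" "tri act g x \<in> U"
  using assms by (auto simp: submodule_def dup_def tri_def subspace_add)

lemma linear_dup_tri:
  assumes "linear (act g)"
  shows "linear (dup act g)" "linear (tri act g)"
  using assms
  by (auto intro!: linearI simp: dup_def tri_def linear_add linear_scale scaleR_add_right)

lemma module_iso_transfer:
  assumes "submodule G act U" and "module_iso G act U act' M"
  obtains \<phi> where "linear \<phi>" "inj_on \<phi> U" "\<And>x. x \<in> U \<Longrightarrow> \<phi> x \<in> M"
    "\<And>g x. g \<in> G \<Longrightarrow> x \<in> U \<Longrightarrow> \<phi> (act g x) = act' g (\<phi> x)"
    "\<And>g x. g \<in> G \<Longrightarrow> x \<in> U \<Longrightarrow> \<phi> (dup act g x) = dup act' g (\<phi> x)"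
    "\<And>g x. g \<in> G \<Longrightarrow> x \<in> U \<Longrightarrow> \<phi> (tri act g x) = tri act' g (\<phi> x)"
proof -
  obtain \<phi> where \<phi>: "linear \<phi>" "bij_betw \<phi> U M" "\<And>g x. g \<in> G \<Longrightarrow> x \<in> U \<Longrightarrow> \<phi> (act g x) = act' g (\<phi> x)"
    using assms(2) unfolding module_iso_def by blast
  have "act g x \<in> U" if "g \<in> G" "x \<in> U" for g x
    using assms(1) that unfolding submodule_def by blast
  then show ?thesis
    using \<phi> by (intro that [of \<phi>]) (auto simp: bij_betw_def dup_def tri_def linear_add)
qed

lemma isotypic_component_subset:
  assumes "\<And>U x. submodule G act U \<Longrightarrow> is_type U \<Longrightarrow> x \<in> U \<Longrightarrow> x \<in> S" and "subspace S"
  shows "isotypic_component G act is_type \<subseteq> S"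
  unfolding isotypic_component_def using assms by (intro span_minimal) auto

lemma isotypic_componentI:
  "submodule G act U \<Longrightarrow> is_type U \<Longrightarrow> x \<in> U \<Longrightarrow> x \<in> isotypic_component G act is_type"
  unfolding isotypic_component_def by (auto intro: span_base)

context slice
begin

definition su_aut :: "complex^3^3 \<Rightarrow> octonion \<Rightarrow> octonion" where
  "su_aut M x = \<psi> (rot M (inv \<psi> x))"

lemma su_aut_psi [simp]: "su_aut M (\<psi> x) = \<psi> (rot M x)"
  by (simp add: su_aut_def)

lemma su_aut_G2: "SU_pair M N \<Longrightarrow> su_aut M \<in> G2"
  using G2_comp [OF psi_G2 G2_comp [OF rot_G2 G2_inv [OF psi_G2]]]
  by (simp add: su_aut_def [abs_def] o_def)

lemma actV_su_aut: "SU_pair M N \<Longrightarrow> actV hat (su_aut M) (pt t x) = pt t (M *v x)"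
  by (intro pt_eqI) (simp add: hat_actV su_aut_G2 hat_pt)

lemma su_aut_SU3: "SU_pair M N \<Longrightarrow> su_aut M \<in> SU3 hat u"
  unfolding SU3_def by (simp add: u_pt actV_su_aut su_aut_G2)

lemma actV_su_aut_inv: "SU_pair M N \<Longrightarrow> actV hat (inv (su_aut M)) (pt t x) = pt t (N *v x)"
  using actV_inv_actV [OF su_aut_G2, of M N "pt t (N *v x)"] by (simp add: actV_su_aut SU_pair_cancel)

lemma dot_matrix: "dot p (M *v x) = dot (p v* M) x"
proof -
  have "dot p (M *v x) = (\<Sum>i\<in>UNIV. \<Sum>j\<in>UNIV. p $ i * (M $ i $ j * x $ j))"
    by (simp add: dot_def matrix_vector_mult_def sum_distrib_left)
  also have "\<dots> = (\<Sum>j\<in>UNIV. \<Sum>i\<in>UNIV. p $ i * (M $ i $ j * x $ j))" by (rule sum.swap)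
  also have "\<dots> = dot (p v* M) x"
    by (simp add: dot_def vector_matrix_mult_def sum_distrib_left sum_distrib_right mult_ac)
  finally show ?thesis .
qed

lemma cvec_matrix: "cvec (M *v x) = cmat M *v cvec x"
  by (simp add: cvec_def cmat_def matrix_vector_mult_def vec_eq_iff)

lemma coords_act:
  assumes w: "coords w c d p q A B" and MN: "SU_pair M N"
  shows "coords (actW hat e (su_aut M) w) c (M *v d) (p v* N) (q v* cmat N) (M ** A ** N) (M ** B ** cmat N)"
  unfolding coords_def
proof (intro allI)
  fix t x
  have "inv \<psi> (ev (actW hat e (su_aut M) w) (pt t x)) =
     oct (of_real t * c + dot p (N *v x) + dot q (cvec (N *v x)))
       (M *v (t *\<^sub>R d + A *v (N *v x) + B *v cvec (N *v x)))"
    by (simp add: ev_actW su_aut_G2 [OF MN] actV_su_aut_inv [OF MN] coordsD [OF w])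
  also have "\<dots> = oct (of_real t * c + dot (p v* N) x + dot (q v* cmat N) (cvec x))
       (t *\<^sub>R (M *v d) + (M ** A ** N) *v x + (M ** B ** cmat N) *v cvec x)"
    by (simp add: cvec_matrix dot_matrix matrix_vector_right_distrib matrix_vector_mul_assoc
        matrix_mul_assoc)
      (simp add: vec_eq_iff matrix_vector_mult_def scaleR_sum_right)
  finally show "inv \<psi> (ev (actW hat e (su_aut M) w) (pt t x)) = \<dots>" .
qed

text \<open>
  The central element \<open>\<omega>\<close> of \<open>SU(3)\<close> fixes \<open>c\<close> and \<open>A\<close> and multiplies every other coordinate by
  a primitive cube root of unity.  It thus separates the blocks \<open>1\<close> and \<open>8\<close> from \<open>6\<close> and \<open>12\<close>.
\<close>

lemma coords_act_center:
  assumes "coords w c d p q A B"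
  shows "coords (actW hat e (su_aut (mat \<omega>)) w) c (\<omega> *s d) (cnj \<omega> *s p) (\<omega> *s q) A (cscale (cnj \<omega>) B)"
proof -
  have s: "\<omega> * (cnj \<omega> * a) = a" "\<omega> * (\<omega> * a) = cnj \<omega> * a" "cnj \<omega> * (\<omega> * a) = a"
    "\<omega> * (a * cnj \<omega>) = a" "\<omega> * (a * \<omega>) = cnj \<omega> * a" "\<omega> * a * cnj \<omega> = a" "\<omega> * a * \<omega> = cnj \<omega> * a" for a
    using omega_cnj omega_square by (simp_all add: mult_ac)
  show ?thesis
    by (rule coords_cong [OF coords_act [OF assms SU_pair_center]])
      (simp_all add: coordinate_defs vec3_eq_iff s)
qed

text \<open>
  The sum of the twelve elements of the tetrahedral group, factored into one plus \<open>sign1\<close>, one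
  plus \<open>sign2\<close>, and the sum of the three powers of \<open>cyc\<close>.
\<close>

definition group_sum :: "((octonion \<Rightarrow> octonion) \<Rightarrow> 'a \<Rightarrow> 'a) \<Rightarrow> 'a \<Rightarrow> 'a::real_vector" where
  "group_sum act x = tri act (su_aut cyc) (dup act (su_aut sign2) (dup act (su_aut sign1) x))"

end

section \<open>The blocks \<open>1\<close>, \<open>6\<close> and \<open>12\<close>\<close>

context slice
begin

abbreviation center :: "octonion \<Rightarrow> octonion" where
  "center \<equiv> su_aut (mat \<omega>)"

lemma SU3_G2: "g \<in> SU3 hat u \<Longrightarrow> g \<in> G2"
  by (simp add: SU3_def)

lemmas elements_SU3 = su_aut_SU3 [OF SU_pair_center] su_aut_SU3 [OF SU_pair_signs(1)]
  su_aut_SU3 [OF SU_pair_signs(2)] su_aut_SU3 [OF SU_pair_cyc]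

lemma group_sum_linear:
  assumes "\<And>g. g \<in> SU3 hat u \<Longrightarrow> linear (act g)"
  shows "linear (group_sum act)"
proof -
  have "group_sum act = tri act (su_aut cyc) \<circ> (dup act (su_aut sign2) \<circ> dup act (su_aut sign1))"
    by (simp add: group_sum_def fun_eq_iff)
  then show ?thesis
    using assms elements_SU3 by (simp add: linear_compose linear_dup_tri)
qed

lemma actW_linear_SU3: "g \<in> SU3 hat u \<Longrightarrow> linear (actW hat e g)"
  by (simp add: actW_linear SU3_G2)

lemma center_fixed_coords:
  assumes w: "coords w c d p q A B" and "actW hat e center w = w"
  shows "d = 0 \<and> p = 0 \<and> q = 0 \<and> B = 0"
proof -
  have "\<omega> *s d = d \<and> cnj \<omega> *s p = p \<and> \<omega> *s q = q \<and> cscale (cnj \<omega>) B = B"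
    using coords_eqD [OF coords_act_center [OF w] ] w assms(2) by metis
  then show ?thesis
    using omega_neq_1 by (simp add: vec_eq_iff cscale_def)
qed

lemma center_moving_coords:
  assumes w: "coords w c d p q A B" and "tri (actW hat e) center w = 0"
  shows "c = 0 \<and> A = 0"
proof -
  note w1 = coords_act_center [OF w]
  have "c + c + c = 0 \<and> A + A + A = 0"
    using coords_eqD [OF coords_add [OF coords_add [OF w w1] coords_act_center [OF w1]]]
      assms(2) coords_0 unfolding tri_def by metis
  then show ?thesis by (simp add: vec_eq_iff)
qed

lemma coords_group_sum:
  assumes w: "coords w c 0 0 0 A 0"
  shows "coords (group_sum (actW hat e) w) (12 * c) 0 0 0 (mat (4 * trace A)) 0"
proof -
  have act: "coords (actW hat e (su_aut M) w) c 0 0 0 (M ** A ** N) 0"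
    if "coords w c 0 0 0 A 0" "SU_pair M N" for w c A M N
    by (rule coords_cong [OF coords_act [OF that]])
      (simp_all add: vec_eq_iff matrix_vector_mult_def vector_matrix_mult_def matrix_matrix_mult_def)
  define w1 where "w1 = dup (actW hat e) (su_aut sign1) w"
  define A1 where "A1 = A + sign1 ** A ** sign1"
  define w2 where "w2 = dup (actW hat e) (su_aut sign2) w1"
  define A2 where "A2 = A1 + sign2 ** A1 ** sign2"
  have w1: "coords w1 (2 * c) 0 0 0 A1 0"
    unfolding w1_def A1_def dup_def
    by (rule coords_cong [OF coords_add [OF w act [OF w SU_pair_signs(1)]]]) simp_all
  have w2: "coords w2 (4 * c) 0 0 0 A2 0"
    unfolding w2_def A2_def dup_def
    by (rule coords_cong [OF coords_add [OF w1 act [OF w1 SU_pair_signs(2)]]]) simp_all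
  note w3 = act [OF w2 SU_pair_cyc]
  have "coords (tri (actW hat e) (su_aut cyc) w2) (12 * c) 0 0 0 (mat (4 * trace A)) 0"
    unfolding tri_def
    by (rule coords_cong [OF coords_add [OF coords_add [OF w2 w3] act [OF w3 SU_pair_cyc]]])
      (simp_all add: group_sum_matrix A1_def A2_def)
  then show ?thesis by (simp add: group_sum_def w1_def w2_def)
qed

lemma group_sum_fixed:
  assumes "\<And>g. g \<in> SU3 hat u \<Longrightarrow> linear (act g)" "\<And>g. g \<in> SU3 hat u \<Longrightarrow> act g x = x"
  shows "group_sum act x = 12 *\<^sub>R x"
proof -
  have "dup act g (r *\<^sub>R x) = (2 * r) *\<^sub>R x" "tri act g (r *\<^sub>R x) = (3 * r) *\<^sub>R x"
    if "g \<in> SU3 hat u" for g r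
    using assms that by (simp_all add: dup_def tri_def linear_scale flip: scaleR_add_left)
  from this(1) [of _ 1] this this(2) show ?thesis
    using elements_SU3 by (simp add: group_sum_def)
qed

lemma coords_scaleR:
  "coords w c d p q A B \<Longrightarrow> coords (r *\<^sub>R w) (r *\<^sub>R c) (r *\<^sub>R d) (r *\<^sub>R p) (r *\<^sub>R q) (r *\<^sub>R A) (r *\<^sub>R B)"
  unfolding coords_def
  by (simp add: inv_psi_simps oct_scaleR coordinate_defs vec3_eq_iff algebra_simps)

lemma block1_fixed:
  assumes "w \<in> block1 hat e u" "g \<in> SU3 hat u"
  shows "actW hat e g w = w"
proof -
  let ?S = "{w. \<forall>g\<in>SU3 hat u. actW hat e g w = w}"
  have "block1 hat e u \<subseteq> ?S"
    unfolding block1_def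
  proof (rule isotypic_component_subset)
    fix U x
    assume U: "submodule (SU3 hat u) (actW hat e) U"
      "module_iso (SU3 hat u) (actW hat e) U (\<lambda>g x. x) (UNIV :: real set)" and x: "x \<in> U"
    obtain \<phi> :: "W \<Rightarrow> real" where \<phi>: "inj_on \<phi> U"
      "\<And>g x. g \<in> SU3 hat u \<Longrightarrow> x \<in> U \<Longrightarrow> \<phi> (actW hat e g x) = \<phi> x"
      using module_iso_transfer [OF U] by metis
    moreover have "actW hat e g x \<in> U" if "g \<in> SU3 hat u" for g
      using U(1) x that unfolding submodule_def by blast
    ultimately show "x \<in> ?S" using x by (auto dest: inj_onD)
  next
    show "subspace ?S"
      using actW_linear_SU3 by (auto simp: subspace_def linear_add linear_scale linear_0)
  qed
  then show ?thesis using assms by blast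
qed

text \<open>
  On an invariant vector, \<open>group_sum\<close> is multiplication by 12; by the formula for \<open>group_sum\<close> the
  matrix \<open>A\<close> is then scalar.
\<close>

lemma fixed_coords:
  assumes "\<And>g. g \<in> SU3 hat u \<Longrightarrow> actW hat e g w = w"
  obtains c a where "coords w c 0 0 0 (mat a) 0"
proof -
  obtain c d p q A B where w: "coords w c d p q A B" using coords_ex by blast
  have w: "coords w c 0 0 0 A 0"
    using center_fixed_coords [OF w] assms elements_SU3(1) w by auto
  have "12 *\<^sub>R A = mat (4 * trace A)"
    using coords_eqD [OF coords_group_sum [OF w]] coords_scaleR [OF w, of 12]
      group_sum_fixed [of "actW hat e" w] actW_linear_SU3 assms by metis
  then have eq: "12 * A $ i $ j = (if i = j then 4 * trace A else 0)" for i j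
    by (simp add: vec_eq_iff mat_def scaleR_conv_of_real)
  have "A $ i $ j = (if i = j then trace A / 3 else 0)" for i j
    using eq [of i j] by (cases "i = j") (simp_all add: complex_eq_iff)
  then have "A = mat (trace A / 3)"
    by (simp add: vec_eq_iff mat_def)
  then show ?thesis using that w by metis
qed

lemma psi_complex: "\<psi> (oct a 0) = Re a *\<^sub>R oone + Im a *\<^sub>R hat u"
proof -
  have "oct a 0 = Re a *\<^sub>R oone + Im a *\<^sub>R oct \<i> 0"
    by (simp add: oone_oct oct_scaleR oct_add complex_eq_iff)
  then show ?thesis by (simp add: psi_simps psi_i)
qed

lemma SU3_psi_complex: 
  assumes "g \<in> SU3 hat u" shows "g (\<psi> (oct a 0)) = \<psi> (oct a 0)"
proof -
  have g: "g \<in> G2" "actV hat g u = u" using assms by (auto simp: SU3_def)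
  then have "g (hat u) = hat u" by (metis hat_actV)
  then show ?thesis
    by (simp add: psi_complex linear_add [OF G2_linear] linear_scale [OF G2_linear] G2_oone g)
qed

lemma SU3_inv_u: 
  assumes "g \<in> SU3 hat u" shows "actV hat (inv g) u = u"
  using assms actV_inv_actV [of g u] by (auto simp: SU3_def)

text \<open>
  The invariants are \<open>v \<mapsto> (v \<bullet> u) c + a v'\<close>, where \<open>v'\<close> is the component of \<open>v\<close> orthogonal to \<open>u\<close>, and
  \<open>c\<close> and \<open>a\<close> are in the slice, which the stabilizer of \<open>u\<close> fixes pointwise.
\<close>

lemma invariant_ex:
  obtains w where "coords w c 0 0 0 (mat a) 0" "\<And>g. g \<in> SU3 hat u \<Longrightarrow> actW hat e g w = w"
proof -
  define L where "L v = (v \<bullet> u) *\<^sub>R \<psi> (oct c 0) + \<psi> (oct a 0) \<odot> hat (v - (v \<bullet> u) *\<^sub>R u)" for v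
  have L: "linear L"
    by (intro linearI)
      (simp_all add: L_def inner_add_left linear_diff [OF hat_linear] linear_add [OF hat_linear]
        linear_scale [OF hat_linear] omult_simps algebra_simps)
  define w where "w = (\<chi> j. L (e j))"
  have ev: "ev w v = L v" for v by (simp add: w_def ev_of_linear [OF L])
  have "coords w c 0 0 0 (mat a) 0"
    unfolding coords_def
  proof (intro allI)
    fix t x
    have "pt t x \<bullet> u = t" "pt t x - t *\<^sub>R u = pt 0 x"
      by (simp_all add: u_pt pt_inner herm_def pt_scaleR diff_eq_eq pt_add)
    then have "L (pt t x) = \<psi> (t *\<^sub>R oct c 0 + oct a 0 \<odot> oct (Complex 0 0) x)"
      by (simp add: L_def hat_pt psi_simps)
    also have "t *\<^sub>R oct c 0 + oct a 0 \<odot> oct (Complex 0 0) x = oct (t * c) (mat a *v x)"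
      by (simp add: oct_mult oct_scaleR oct_add coordinate_defs herm_def conj_cross_def vec3_eq_iff
          scaleR_conv_of_real complex_eq_iff)
    finally show "inv \<psi> (ev w (pt t x)) = oct (of_real t * c + dot 0 x + dot 0 (cvec x))
        (t *\<^sub>R 0 + mat a *v x + 0 *v cvec x)"
      by (simp add: ev coordinate_defs vec3_eq_iff)
  qed
  moreover have "actW hat e g w = w" if g: "g \<in> SU3 hat u" for g
  proof (rule ev_eqI)
    fix v
    note G2 = SU3_G2 [OF g]
    have "ev (actW hat e g w) v = g (L (actV hat (inv g) v))"
      by (simp add: ev_actW G2 ev)
    also have "actV hat (inv g) v \<bullet> u = v \<bullet> u"
      using actV_inner [OF G2_inv [OF G2], of v u] SU3_inv_u [OF g] by simp
    then have "g (L (actV hat (inv g) v)) = (v \<bullet> u) *\<^sub>R \<psi> (oct c 0) +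
        \<psi> (oct a 0) \<odot> g (hat (actV hat (inv g) v - (v \<bullet> u) *\<^sub>R u))"
      by (simp add: L_def linear_add [OF G2_linear] linear_scale [OF G2_linear] G2 G2_mult SU3_psi_complex [OF g])
    also have "g (hat (actV hat (inv g) v - (v \<bullet> u) *\<^sub>R u)) =
        hat (actV hat g (actV hat (inv g) v - (v \<bullet> u) *\<^sub>R u))"
      by (simp add: hat_actV G2)
    also have "actV hat g (actV hat (inv g) v - (v \<bullet> u) *\<^sub>R u) = v - (v \<bullet> u) *\<^sub>R u"
      using g by (simp add: linear_diff [OF actV_linear] linear_scale [OF actV_linear] G2 SU3_def)
    finally show "ev (actW hat e g w) v = ev w v" by (simp add: ev L_def)
  qed
  ultimately show ?thesis using that by blast
qed

lemma fixed_in_block1: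
  assumes fixed: "\<And>g. g \<in> SU3 hat u \<Longrightarrow> actW hat e g w = w" and "w \<noteq> 0"
  shows "w \<in> block1 hat e u"
  unfolding block1_def
proof (rule isotypic_componentI)
  have act: "actW hat e g x = x" if "g \<in> SU3 hat u" "x \<in> span {w}" for g x
    using that fixed actW_linear_SU3 by (auto simp: span_singleton linear_scale)
  then show "submodule (SU3 hat u) (actW hat e) (span {w})"
    by (simp add: submodule_def)
  define \<phi> where "\<phi> x = (x \<bullet> w) / (w \<bullet> w)" for x
  have "linear \<phi>"
    by (intro linearI) (simp_all add: \<phi>_def inner_add_left add_divide_distrib)
  moreover have "\<phi> (r *\<^sub>R w) = r" for r using \<open>w \<noteq> 0\<close> by (simp add: \<phi>_def)
  then have "bij_betw \<phi> (span {w}) UNIV"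
    by (intro bij_betw_byWitness [where f' = "\<lambda>r. r *\<^sub>R w"]) (auto simp: span_singleton)
  ultimately show "module_iso (SU3 hat u) (actW hat e) (span {w}) (\<lambda>g x. x) (UNIV :: real set)"
    unfolding module_iso_def using act by (intro exI [of _ \<phi>]) auto
  show "w \<in> span {w}" by (simp add: span_base)
qed

lemma block1_contributes:
  "contributes hat e (block1 hat e u) (slice_point hat u \<mu> Q) \<longleftrightarrow> (\<mu>, Q) \<in> quartic"
proof
  assume "contributes hat e (block1 hat e u) (slice_point hat u \<mu> Q)"
  then obtain w where w: "w \<in> block1 hat e u" "w \<noteq> 0" "h hat e w = rmul e (slice_point hat u \<mu> Q) w"
    unfolding contributes_def by blast
  obtain c a where ca: "coords w c 0 0 0 (mat a) 0"
    using fixed_coords [of w] block1_fixed [OF w(1)] by blast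
  show "(\<mu>, Q) \<in> quartic"
  proof (rule ccontr)
    assume "(\<mu>, Q) \<notin> quartic"
    then have "c = 0" "a = 0" using eigen_invariants [OF ca w(3)] by (auto simp: trace_scalar)
    then show False using ca w(2) coords_inj [OF _ coords_0] by (auto simp: mat_0)
  qed
next
  assume "(\<mu>, Q) \<in> quartic"
  then obtain c a where ca: "c \<noteq> 0"
    "\<And>w. coords w c 0 0 0 (mat a) 0 \<Longrightarrow> h hat e w = rmul e (slice_point hat u \<mu> Q) w"
    using quartic_eigenvector by blast
  obtain w where w: "coords w c 0 0 0 (mat a) 0" "\<And>g. g \<in> SU3 hat u \<Longrightarrow> actW hat e g w = w"
    using invariant_ex by blast
  have "w \<noteq> 0" using coords_eqD [OF w(1)] coords_0 ca(1) by metis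
  then show "contributes hat e (block1 hat e u) (slice_point hat u \<mu> Q)"
    unfolding contributes_def using fixed_in_block1 w ca(2) by blast
qed

lemma subspace_tri_kernel: "subspace {w. tri (actW hat e) center w = 0}"
  by (rule linear_subspace_kernel [OF linear_dup_tri(2) [where act = "actW hat e", OF actW_linear_SU3 [OF elements_SU3(1)]]])

lemma omega_tri: "x + \<omega> *s x + (\<omega> * \<omega>) *s x = (0 :: complex^3)"
proof -
  have "a + \<omega> * a + \<omega> * \<omega> * a = (1 + \<omega> + cnj \<omega>) * a" for a
    by (simp add: algebra_simps omega_square [symmetric])
  then show ?thesis by (simp add: vec_eq_iff omega_sum)
qed

lemma mat_vector: "mat a *v x = a *s (x :: complex^3)"
  by (simp add: coordinate_defs vec3_eq_iff)

lemma block6_tri: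
  assumes "w \<in> block6 hat e u" shows "tri (actW hat e) center w = 0"
proof -
  have "block6 hat e u \<subseteq> {w. tri (actW hat e) center w = 0}"
    unfolding block6_def
  proof (rule isotypic_component_subset [OF _ subspace_tri_kernel])
    fix U x
    assume U: "submodule (SU3 hat u) (actW hat e) U"
      "module_iso (SU3 hat u) (actW hat e) U (actV hat) {v. v \<bullet> u = 0}" and x: "x \<in> U"
    obtain \<phi> where \<phi>: "linear \<phi>" "inj_on \<phi> U" "\<And>x. x \<in> U \<Longrightarrow> \<phi> x \<in> {v. v \<bullet> u = 0}"
      "\<And>g x. g \<in> SU3 hat u \<Longrightarrow> x \<in> U \<Longrightarrow> \<phi> (tri (actW hat e) g x) = tri (actV hat) g (\<phi> x)"
      using module_iso_transfer [OF U] by metis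
    obtain t y where y: "\<phi> x = pt t y" by (rule pt_cases)
    have "t = 0" using \<phi>(3) [OF x] y by (simp add: u_pt pt_inner herm_def)
    then have "\<phi> (tri (actW hat e) center x) = 0"
      using \<phi>(4) x elements_SU3(1) y
      by (simp add: tri_def actV_su_aut [OF SU_pair_center] mat_vector pt_add omega_tri)
    moreover have "0 \<in> U" using U(1) by (simp add: submodule_def subspace_0)
    ultimately show "x \<in> {w. tri (actW hat e) center w = 0}"
      using inj_onD [OF \<phi>(2) _ submodule_dup_tri(2) [OF U(1) elements_SU3(1) x]] linear_0 [OF \<phi>(1)]
      by simp
  qed
  then show ?thesis using assms by blast
qed

text \<open>
  A form of type \<open>S2_3\<close> or \<open>S2_3bar\<close> is complex bilinear for one of the two complex structures;
  therefore the inverse of \<open>\<omega>\<close> acts by the square of a primitive cube root of unity.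
\<close>

lemma form_scalar:
  assumes "\<beta> \<in> S2_3 hat u \<or> \<beta> \<in> S2_3bar hat u"
  obtains \<kappa> where "\<kappa> = \<omega> \<or> \<kappa> = cnj \<omega>"
    "\<And>t s x y. blinfun_apply (\<beta> (pt t (cnj \<omega> *s x))) (pt s (cnj \<omega> *s y)) =
       \<kappa> * blinfun_apply (\<beta> (pt t x)) (pt s y)"
proof -
  obtain J where J: "\<beta> \<in> S2_dual u J" and "J = crossV hat u \<or> J = (\<lambda>x. - crossV hat u x)"
    using assms unfolding S2_3_def S2_3bar_def by blast
  then obtain \<sigma> :: real where \<sigma>: "\<sigma> = 1 \<or> \<sigma> = -1" and J_def: "\<And>v. J v = \<sigma> *\<^sub>R crossV hat u v"
    by (metis scaleR_minus1_left scaleR_one)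
  have sym: "\<beta> a b = \<beta> b a" and JC: "\<beta> (J a) b = \<i> * \<beta> a b" and u0: "\<beta> u b = 0" for a b
    using J by (auto simp: S2_dual_def)
  \<comment> \<open>the scalar by which the matrix \<open>cnj \<omega>\<close> acts on one argument, where \<open>\<sigma>\<close> is the sign of the complex structure\<close>
  define \<kappa> where "\<kappa> = Complex (- 1 / 2) (- \<sigma> * sqrt 3 / 2)"
  have one: "\<beta> (pt t (cnj \<omega> *s x)) b = \<kappa> * \<beta> (pt t x) b" for t x b
  proof -
    have drop: "\<beta> (pt t x) b = \<beta> (pt 0 x) b" for t x
    proof -
      have "pt t x = t *\<^sub>R u + pt 0 x" by (simp add: u_pt pt_scaleR pt_add)
      then show ?thesis by (simp add: blinfun.add_right blinfun.scaleR_right blinfun.add_left blinfun.scaleR_left u0)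
    qed
    have "pt 0 (cnj \<omega> *s x) = (- 1 / 2) *\<^sub>R pt 0 x + (- \<sigma> * sqrt 3 / 2) *\<^sub>R J (pt 0 x)"
      using \<sigma> by (auto simp: J_def cross_u pt_scaleR pt_add \<omega>_def vec3_eq_iff complex_eq_iff)
    then have "\<beta> (pt 0 (cnj \<omega> *s x)) b = of_real (- 1 / 2) * \<beta> (pt 0 x) b + of_real (- \<sigma> * sqrt 3 / 2) * (\<i> * \<beta> (pt 0 x) b)"
      by (simp only: blinfun.add_right blinfun.scaleR_right blinfun.add_left blinfun.scaleR_left JC scaleR_conv_of_real)
    also have "\<dots> = \<kappa> * \<beta> (pt 0 x) b"
      by (simp add: \<kappa>_def complex_eq_iff)
    finally show ?thesis by (simp add: drop [of t])
  qed
  have two: "\<beta> (pt t (cnj \<omega> *s x)) (pt s (cnj \<omega> *s y)) = \<kappa> * \<kappa> * \<beta> (pt t x) (pt s y)" for t s x y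
    unfolding one sym [of "pt t x" "pt s (cnj \<omega> *s y)"] one
    by (simp add: sym [of "pt s y"])
  have "\<kappa> * \<kappa> = \<omega> \<or> \<kappa> * \<kappa> = cnj \<omega>"
    using \<sigma> by (auto simp: \<kappa>_def \<omega>_def complex_eq_iff)
  then show ?thesis using that two by blast
qed

lemma actForm_apply:
  assumes "g \<in> G2"
  shows "blinfun_apply (actForm hat g \<beta> x) y = \<beta> (actV hat (inv g) x) (actV hat (inv g) y)"
proof -
  note l = actV_linear [OF G2_inv [OF assms]]
  have 1: "bounded_linear (\<lambda>y. \<beta> (actV hat (inv g) x) (actV hat (inv g) y))" for x
    unfolding linear_conv_bounded_linear [symmetric]
    by (intro linearI) (simp_all add: linear_add [OF l] linear_scale [OF l] blinfun.add_right blinfun.scaleR_right)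
  have 2: "bounded_linear (\<lambda>x. Blinfun (\<lambda>y. \<beta> (actV hat (inv g) x) (actV hat (inv g) y)))"
    unfolding linear_conv_bounded_linear [symmetric]
    by (intro linearI blinfun_eqI;
        simp only: bounded_linear_Blinfun_apply [OF 1] blinfun.add_left blinfun.scaleR_left)
      (simp_all add: linear_add [OF l] linear_scale [OF l]
        blinfun.add_right blinfun.scaleR_right blinfun.add_left blinfun.scaleR_left)
  show ?thesis
    by (simp add: actForm_def bounded_linear_Blinfun_apply [OF 1] bounded_linear_Blinfun_apply [OF 2])
qed

lemma form_tri:
  assumes "\<beta> \<in> S2_3 hat u \<or> \<beta> \<in> S2_3bar hat u"
  shows "\<beta> + actForm hat center \<beta> + actForm hat center (actForm hat center \<beta>) = 0"
proof (intro blinfun_eqI)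
  fix v w
  obtain \<kappa> where chi: "\<kappa> = \<omega> \<or> \<kappa> = cnj \<omega>"
    "\<And>t s x y. blinfun_apply (\<beta> (pt t (cnj \<omega> *s x))) (pt s (cnj \<omega> *s y)) =
       \<kappa> * blinfun_apply (\<beta> (pt t x)) (pt s y)"
    using form_scalar [OF assms] by blast
  obtain t x s y where vw: "v = pt t x" "w = pt s y" by (metis pt_cases)
  have G2: "center \<in> G2" by (rule su_aut_G2 [OF SU_pair_center])
  have sum: "blinfun_apply (blinfun_apply (\<beta> + actForm hat center \<beta> + actForm hat center (actForm hat center \<beta>)) v) w =
      (1 + \<kappa> + \<kappa> * \<kappa>) * \<beta> v w"
    by (simp only: blinfun.add_left actForm_apply [OF G2] vw actV_su_aut_inv [OF SU_pair_center]
        mat_vector chi(2)) (simp add: algebra_simps)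
  have "1 + \<omega> + \<omega> * \<omega> = 0" "1 + cnj \<omega> + cnj \<omega> * cnj \<omega> = 0"
    by (simp_all add: \<omega>_def complex_eq_iff)
  then have "1 + \<kappa> + \<kappa> * \<kappa> = 0"
    using chi(1) by metis
  then show "blinfun_apply (blinfun_apply (\<beta> + actForm hat center \<beta> + actForm hat center (actForm hat center \<beta>)) v) w =
    blinfun_apply (blinfun_apply 0 v) w" using sum by simp
qed

text \<open>
  The isomorphism is only given on the complexification, but restricting it to pairs \<open>(x, 0)\<close>
  suffices to carry the identity of \<open>form_tri\<close> over to \<open>x\<close>.
\<close>

lemma block12_tri:
  assumes "w \<in> block12 hat e u" shows "tri (actW hat e) center w = 0"
proof -
  let ?a = "actW hat e center"
  have lin: "linear ?a" using actW_linear_SU3 elements_SU3(1) by blast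
  have "block12 hat e u \<subseteq> {w. tri (actW hat e) center w = 0}"
    unfolding block12_def
  proof (rule isotypic_component_subset [OF _ subspace_tri_kernel])
    fix U x
    assume U: "submodule (SU3 hat u) (actW hat e) U" "is_type12 hat e u U" and x: "x \<in> U"
    obtain \<Phi> :: "W \<times> W \<Rightarrow> ('v \<Rightarrow>\<^sub>L 'v \<Rightarrow>\<^sub>L complex) \<times> ('v \<Rightarrow>\<^sub>L 'v \<Rightarrow>\<^sub>L complex)"
      where \<Phi>: "linear \<Phi>" "bij_betw \<Phi> (U \<times> U) (S2_3 hat u \<times> S2_3bar hat u)"
        "\<And>x y. x \<in> U \<Longrightarrow> y \<in> U \<Longrightarrow> \<Phi> (?a x, ?a y) = map_prod (actForm hat center) (actForm hat center) (\<Phi> (x, y))"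
      using U(2) elements_SU3(1) unfolding is_type12_def by blast
    have 0: "0 \<in> U" and a: "\<And>x. x \<in> U \<Longrightarrow> ?a x \<in> U"
      using U(1) elements_SU3(1) by (auto simp: submodule_def subspace_0)
    obtain \<beta> \<gamma> where bg: "\<Phi> (x, 0) = (\<beta>, \<gamma>)" by fastforce
    then have "\<beta> \<in> S2_3 hat u" "\<gamma> \<in> S2_3bar hat u"
      using bij_betw_apply [OF \<Phi>(2), of "(x, 0)"] x 0 by auto
    then have tri: "\<beta> + actForm hat center \<beta> + actForm hat center (actForm hat center \<beta>) = 0"
      "\<gamma> + actForm hat center \<gamma> + actForm hat center (actForm hat center \<gamma>) = 0"
      using form_tri by blast+
    have sum: "(tri (actW hat e) center x, 0) = (x, 0) + (?a x, ?a 0) + (?a (?a x), ?a (?a 0))"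
      by (simp add: tri_def linear_0 [OF lin])
    have "\<Phi> (tri (actW hat e) center x, 0) = 0"
      unfolding sum linear_add [OF \<Phi>(1)]
      using x 0 a tri by (simp add: \<Phi>(3) bg zero_prod_def)
    also have "0 = \<Phi> (0, 0)" using linear_0 [OF \<Phi>(1)] by (simp add: zero_prod_def)
    finally show "x \<in> {w. tri (actW hat e) center w = 0}"
      using bij_betw_imp_inj_on [OF \<Phi>(2)] submodule_dup_tri(2) [OF U(1) elements_SU3(1) x] 0
      by (auto dest: inj_onD)
  qed
  then show ?thesis using assms by blast
qed

text \<open>
  The blocks \<open>6\<close> and \<open>12\<close> can be treated together: both are annihilated by \<open>1 + \<omega> + \<omega>\<^sup>2\<close>, which leaves
  no room for \<open>c\<close> and \<open>A\<close>.
\<close>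

lemma tri_not_contributes:
  assumes "\<And>w. w \<in> S \<Longrightarrow> tri (actW hat e) center w = 0" and "Q \<noteq> 0"
  shows "\<not> contributes hat e S (slice_point hat u \<mu> Q)"
proof
  assume "contributes hat e S (slice_point hat u \<mu> Q)"
  then obtain w where w: "w \<in> S" "w \<noteq> 0" "h hat e w = rmul e (slice_point hat u \<mu> Q) w"
    unfolding contributes_def by blast
  obtain c d p q A B where c: "coords w c d p q A B" using coords_ex by blast
  then have "coords w 0 d p q 0 B" using center_moving_coords assms(1) [OF w(1)] by metis
  then show False using eigen_moving w assms(2) by blast
qed

end

section \<open>The block \<open>8\<close>\<close>

context slice
begin

definition endo :: "('v \<Rightarrow>\<^sub>L 'v) \<Rightarrow> complex^3^3 \<Rightarrow> bool" where
  "endo A K \<longleftrightarrow> (\<forall>t x. A (pt t x) = pt 0 (K *v x))"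

lemma endoD: "endo A K \<Longrightarrow> A (pt t x) = pt 0 (K *v x)"
  by (simp add: endo_def)

lemma actEnd_apply:
  assumes "g \<in> G2"
  shows "blinfun_apply (actEnd hat g A) v = actV hat g (A (actV hat (inv g) v))"
proof -
  note l = actV_linear [OF G2_inv [OF assms]] and l' = actV_linear [OF assms]
  have "bounded_linear (\<lambda>v. actV hat g (A (actV hat (inv g) v)))"
    unfolding linear_conv_bounded_linear [symmetric]
    by (intro linearI)
      (simp_all add: linear_add [OF l] linear_scale [OF l] linear_add [OF l'] linear_scale [OF l']
        blinfun.add_right blinfun.scaleR_right)
  then show ?thesis by (simp add: actEnd_def bounded_linear_Blinfun_apply)
qed

lemma endo_ex: "\<exists>A. endo A K"
proof -
  define f where "f v = pt 0 (K *v (THE x. \<exists>t. v = pt t x))" for v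
  have f: "f (pt t x) = pt 0 (K *v x)" for t x
  proof -
    have "(THE y. \<exists>s. pt t x = pt s y) = x" by (rule the_equality) auto
    then show ?thesis by (simp only: f_def)
  qed
  have K: "K *v (r *\<^sub>R x) = r *\<^sub>R (K *v x)" for r and x :: "complex^3"
    by (simp add: vec_eq_iff matrix_vector_mult_def scaleR_sum_right)
  have "linear f"
  proof (rule linearI)
    fix v w :: 'v and r :: real
    obtain t x s y where [simp]: "v = pt t x" "w = pt s y" by (metis pt_cases)
    show "f (v + w) = f v + f w"
      by (simp add: pt_add f matrix_vector_right_distrib)
    show "f (r *\<^sub>R v) = r *\<^sub>R f v"
      by (simp add: pt_scaleR f K)
  qed
  then have "bounded_linear f" by (simp add: linear_conv_bounded_linear)
  then have "endo (Blinfun f) K"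
    by (simp add: endo_def bounded_linear_Blinfun_apply f)
  then show ?thesis by blast
qed

lemma endo_eqI: "endo A K \<Longrightarrow> endo B K \<Longrightarrow> A = B"
  by (intro blinfun_eqI) (metis endoD pt_cases)

lemma endo_zero: "endo 0 0"
  by (simp add: endo_def)

lemma endo_add: "endo A K \<Longrightarrow> endo B L \<Longrightarrow> endo (A + B) (K + L)"
  by (simp add: endo_def blinfun.add_left pt_add matrix_vector_mult_add_rdistrib)

lemma endo_scaleR: "endo A K \<Longrightarrow> endo (r *\<^sub>R A) (r *\<^sub>R K)"
  by (simp add: endo_def blinfun.scaleR_left pt_scaleR vec_eq_iff matrix_vector_mult_def scaleR_sum_right)

lemma endo_act: "endo A K \<Longrightarrow> SU_pair M N \<Longrightarrow> endo (actEnd hat (su_aut M) A) (M ** K ** N)"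
  by (simp add: endo_def actEnd_apply [OF su_aut_G2] actV_su_aut actV_su_aut_inv matrix_vector_mul_assoc
      matrix_mul_assoc)

lemma cross_u_linear: "linear (crossV hat u)"
proof (rule linearI)
  fix v w :: 'v and r :: real
  obtain t x s y where [simp]: "v = pt t x" "w = pt s y" by (metis pt_cases)
  show "crossV hat u (v + w) = crossV hat u v + crossV hat u w"
    by (simp add: pt_add cross_u)
  show "crossV hat u (r *\<^sub>R v) = r *\<^sub>R crossV hat u v"
    by (simp add: pt_scaleR cross_u) (simp add: vec_eq_iff)
qed

lemma ctrace_endo:
  assumes "endo A K" shows "ctrace e (crossV hat u) A = trace K"
proof -
  have bil: "bilinear (\<lambda>a b. A a \<bullet> b)" "bilinear (\<lambda>a b. crossV hat u (A a) \<bullet> b)"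
    unfolding bilinear_def
    by (auto intro!: linearI simp: blinfun.add_right blinfun.scaleR_right inner_add_left inner_add_right
        linear_add [OF cross_u_linear] linear_scale [OF cross_u_linear])
  show ?thesis
    unfolding ctrace_def sum_basis [OF bil(1)] sum_basis [OF bil(2)]
    by (simp add: endoD [OF assms] u_pt cross_u [unfolded u_pt] pt_inner herm_def coordinate_defs
        axis_def complex_eq_iff)
qed

text \<open>
  Membership in \<open>su_perp\<close> becomes a condition on matrices, so that the group elements given by
  matrices can be applied to it.
\<close>

lemma su_perp_iff:
  assumes "endo A K"
  shows "A \<in> su_perp hat e u \<longleftrightarrow> adjoint_mat K = - K \<and> trace K = 0"
proof -
  have "A u = 0" using endoD [OF assms, of 1 0] by (simp add: u_pt)
  moreover have "A (crossV hat u v) = crossV hat u (A v)" for v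
    by (rule pt_cases [of v]) (simp add: cross_u endoD [OF assms] vector_scalar_mult_matrix)
  moreover have "(\<forall>v w. A v \<bullet> w = - (v \<bullet> A w)) \<longleftrightarrow> adjoint_mat K = - K"
  proof
    assume skew: "\<forall>v w. A v \<bullet> w = - (v \<bullet> A w)"
    have "cnj (K $ j $ i) = - K $ i $ j" for i j
    proof -
      have "A (pt 0 (axis j a)) \<bullet> pt 0 (axis i 1) = - (pt 0 (axis j a) \<bullet> A (pt 0 (axis i 1)))" for a
        using skew by blast
      then have "Re (herm (K *v axis j a) (axis i 1)) = - Re (herm (axis j a) (K *v axis i 1))" for a
        by (simp add: endoD [OF assms] pt_inner)
      moreover have "herm (K *v axis j a) (axis i 1) = K $ i $ j * a"
        "herm (axis j a) (K *v axis i 1) = a * cnj (K $ j $ i)" for a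
        by (simp_all add: herm_def axis_def matrix_vector_mult_def if_distrib [of cnj]
            if_distrib [of "\<lambda>z. _ * z"] if_distrib [of "\<lambda>z. z * _"] cong: if_cong)
      ultimately have "Re (K $ i $ j * a) = - Re (a * cnj (K $ j $ i))" for a by metis
      from this [of 1] this [of \<i>] show ?thesis by (simp add: complex_eq_iff)
    qed
    then show "adjoint_mat K = - K" by (simp add: adjoint_mat_def vec_eq_iff)
  next
    assume "adjoint_mat K = - K"
    then have K: "cnj (K $ j $ i) = - K $ i $ j" for i j by (simp add: adjoint_mat_def vec_eq_iff)
    have "herm (K *v x) y = - herm x (K *v y)" for x y
    proof -
      have "herm x (K *v y) = (\<Sum>i\<in>UNIV. \<Sum>j\<in>UNIV. x $ i * (cnj (K $ i $ j) * cnj (y $ j)))"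
        by (simp add: herm_def matrix_vector_mult_def sum_distrib_left)
      also have "\<dots> = (\<Sum>j\<in>UNIV. \<Sum>i\<in>UNIV. x $ i * (cnj (K $ i $ j) * cnj (y $ j)))"
        by (rule sum.swap)
      also have "\<dots> = - herm (K *v x) y"
        by (simp add: K herm_def matrix_vector_mult_def sum_distrib_left sum_distrib_right sum_negf mult_ac)
      finally show ?thesis by simp
    qed
    then show "\<forall>v w. A v \<bullet> w = - (v \<bullet> A w)"
      by (metis (no_types, lifting) endoD [OF assms] pt_cases pt_inner mult_zero_left mult_zero_right
          add_0 uminus_complex.sel(1))
  qed
  ultimately show ?thesis
    unfolding su_perp_def by (simp add: ctrace_endo [OF assms])
qed

lemma su_perp_endo:
  assumes "A \<in> su_perp hat e u" obtains K where "endo A K"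
proof -
  have Au: "A u = 0" and skew: "\<And>v w. A v \<bullet> w = - (v \<bullet> A w)"
    and J: "\<And>v. A (crossV hat u v) = crossV hat u (A v)"
    using assms by (auto simp: su_perp_def)
  define f where "f x = (THE y. A (pt 0 x) = pt 0 y)" for x
  have f: "A (pt 0 x) = pt 0 (f x)" for x
  proof -
    obtain t y where y: "A (pt 0 x) = pt t y" by (rule pt_cases)
    have "pt t y \<bullet> u = 0" using skew [of "pt 0 x" u] Au y by simp
    then show ?thesis using y by (simp add: f_def u_pt pt_inner herm_def)
  qed
  have f_add: "f (x + y) = f x + f y" for x y
    using blinfun.add_right [of A "pt 0 x" "pt 0 y"] by (simp add: pt_add f)
  have f_scaleR: "f (r *\<^sub>R x) = r *\<^sub>R f x" for r x
    using blinfun.scaleR_right [of A r "pt 0 x"] by (simp add: pt_scaleR f)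
  have f_i: "f (\<i> *s x) = \<i> *s f x" for x
    using J [of "pt 0 x"] by (simp add: cross_u f)
  have f_scale: "f (a *s x) = a *s f x" for a x
  proof -
    have "a *s y = Re a *\<^sub>R y + Im a *\<^sub>R (\<i> *s y)" for y :: "complex^3"
      by (simp add: vec_eq_iff complex_eq_iff)
    then show ?thesis by (metis f_add f_scaleR f_i)
  qed
  define K where "K = (\<chi> i j. f (axis j 1) $ i)"
  have "f x = K *v x" for x
  proof -
    have "x = x$1 *s axis 1 1 + x$2 *s axis 2 1 + x$3 *s axis 3 1"
      by (simp add: vec3_eq_iff axis_def)
    then have "f x = x$1 *s f (axis 1 1) + x$2 *s f (axis 2 1) + x$3 *s f (axis 3 1)"
      by (metis f_add f_scale)
    then show ?thesis
      by (simp add: K_def vec_eq_iff matrix_vector_mult_def sum_3)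
  qed
  moreover have "A (pt t x) = A (pt 0 x)" for t x
  proof -
    have "pt t x = t *\<^sub>R u + pt 0 x" by (simp add: u_pt pt_scaleR pt_add)
    then show ?thesis by (simp add: blinfun.add_right blinfun.scaleR_right Au)
  qed
  ultimately show ?thesis using that [of K] f by (simp add: endo_def)
qed

lemma su_perp_cases:
  assumes "A \<in> su_perp hat e u"
  obtains K where "endo A K" "adjoint_mat K = - K" "trace K = 0"
  using assms su_perp_endo su_perp_iff by metis

lemma subspace_su_perp: "subspace (su_perp hat e u)"
proof (rule subspaceI)
  show "0 \<in> su_perp hat e u"
    by (simp add: su_perp_iff [OF endo_zero] adjoint_mat_def trace_def vec_eq_iff)
next
  fix A B assume "A \<in> su_perp hat e u" "B \<in> su_perp hat e u"
  then obtain K L where "endo A K" "adjoint_mat K = - K" "trace K = 0"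
    "endo B L" "adjoint_mat L = - L" "trace L = 0" by (metis su_perp_cases)
  then show "A + B \<in> su_perp hat e u"
    by (simp add: su_perp_iff [OF endo_add] trace_add) (simp add: adjoint_mat_def vec_eq_iff)
next
  fix r A assume "A \<in> su_perp hat e u"
  then obtain K where "endo A K" "adjoint_mat K = - K" "trace K = 0" by (metis su_perp_cases)
  then show "r *\<^sub>R A \<in> su_perp hat e u"
    by (simp add: su_perp_iff [OF endo_scaleR]) (simp add: adjoint_mat_def vec_eq_iff trace_def flip: scaleR_sum_right)
qed

lemma hat_crossV: "hat (crossV hat a b) = hat a \<odot> hat b + (a \<bullet> b) *\<^sub>R oone"
proof -
  obtain r s x y where ab: "hat a = oct r x" "hat b = oct s y" by (metis oct_cases)
  then have "Re r = 0" "Re s = 0" using hat_ImO [of a] hat_ImO [of b] by auto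
  then have "hat a \<odot> hat b + (a \<bullet> b) *\<^sub>R oone \<in> ImO"
    by (simp add: ab oct_mult oone_oct oct_scaleR oct_add inner_oct flip: hat_inner)
  then show ?thesis by (simp add: crossV_def)
qed

lemma crossV_equivariant:
  assumes "g \<in> G2" shows "actV hat g (crossV hat a b) = crossV hat (actV hat g a) (actV hat g b)"
  using assms
  by (intro injD [OF hat_inj])
    (simp add: hat_actV hat_crossV actV_inner linear_add [OF G2_linear] linear_scale [OF G2_linear]
      G2_mult G2_oone)

text \<open>
  For a general element of the stabilizer no matrix is at hand.  The trace condition is instead
  preserved because traces may be computed in the transported orthonormal basis.
\<close>

lemma actEnd_su_perp:
  assumes g: "g \<in> SU3 hat u" and A: "A \<in> su_perp hat e u"
  shows "actEnd hat g A \<in> su_perp hat e u"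
proof -
  note G2 = SU3_G2 [OF g] and gu = SU3_inv_u [OF g]
  note l = actV_linear [OF G2_inv [OF G2]] and l' = actV_linear [OF G2]
  let ?g = "actV hat g" and ?g' = "actV hat (inv g)"
  have Au: "A u = 0" and skew: "\<And>v w. A v \<bullet> w = - (v \<bullet> A w)"
    and J: "\<And>v. A (crossV hat u v) = crossV hat u (A v)" and tr: "ctrace e (crossV hat u) A = 0"
    using A by (auto simp: su_perp_def)
  have gJ: "?g (crossV hat u v) = crossV hat u (?g v)" for v
    using g by (simp add: crossV_equivariant [OF G2] SU3_def)
  have gJ': "?g' (crossV hat u v) = crossV hat u (?g' v)" for v
    by (simp add: crossV_equivariant [OF G2_inv [OF G2]] gu)
  have exp: "(\<Sum>j\<in>UNIV. (v \<bullet> ?g' (e j)) *\<^sub>R ?g' (e j)) = v" for v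
    using arg_cong [OF expansion [of "?g v"], of ?g'] actV_adjoint [OF G2]
    by (simp add: linear_sum [OF l] linear_scale [OF l] G2)
  have tr_inv: "(\<Sum>j\<in>UNIV. ?g (B (?g' (e j))) \<bullet> e j) = (\<Sum>j\<in>UNIV. B (e j) \<bullet> e j)" if "linear B" for B
  proof -
    have "bilinear (\<lambda>a b. B a \<bullet> b)"
      using that unfolding bilinear_def
      by (auto intro!: linearI simp: linear_add linear_scale inner_add_left inner_add_right)
    from contraction [OF this exp] show ?thesis by (simp add: actV_adjoint [OF G2])
  qed
  have "linear (blinfun_apply A)" "linear (\<lambda>v. crossV hat u (A v))"
    using linear_compose [OF _ cross_u_linear, of "blinfun_apply A"]
    by (simp_all add: bounded_linear.linear blinfun.bounded_linear_right o_def)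
  note trs = this [THEN tr_inv]
  have "ctrace e (crossV hat u) (actEnd hat g A) = ctrace e (crossV hat u) A"
    by (simp add: ctrace_def actEnd_apply [OF G2] trs flip: gJ)
  moreover have "?g (A (?g' x)) \<bullet> y = - (x \<bullet> ?g (A (?g' y)))" for x y
    by (simp add: actV_adjoint [OF G2] inner_commute [of x]) (metis skew inner_commute)
  ultimately show ?thesis
    unfolding su_perp_def using tr
    by (simp add: actEnd_apply [OF G2] gu Au linear_0 [OF l'] gJ' J gJ)
qed

lemma center_su_perp:
  assumes "A \<in> su_perp hat e u" shows "actEnd hat center A = A"
proof -
  obtain K where K: "endo A K" using assms su_perp_endo by blast
  have "mat \<omega> ** K ** mat (cnj \<omega>) = K"
  proof -
    have "\<omega> * (k * cnj \<omega>) = k" "\<omega> * k * cnj \<omega> = k" for k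
      using omega_cnj by (simp_all add: mult_ac)
    then show ?thesis by (simp add: coordinate_defs vec3_eq_iff)
  qed
  then show ?thesis using endo_act [OF K SU_pair_center] K endo_eqI by metis
qed

lemma group_sum_su_perp:
  assumes "A \<in> su_perp hat e u" shows "group_sum (actEnd hat) A = 0"
proof -
  obtain K where K: "endo A K" "trace K = 0" using assms by (metis su_perp_cases)
  note 1 = endo_add [OF K(1) endo_act [OF K(1) SU_pair_signs(1)]]
  note 2 = endo_add [OF 1 endo_act [OF 1 SU_pair_signs(2)]]
  note 3 = endo_act [OF 2 SU_pair_cyc]
  note 4 = endo_add [OF endo_add [OF 2 3] endo_act [OF 3 SU_pair_cyc]]
  have "endo (group_sum (actEnd hat) A) (mat (4 * trace K))"
    unfolding group_sum_def tri_def dup_def using 4 unfolding group_sum_matrix .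
  then show ?thesis using K(2) endo_zero endo_eqI by (simp add: mat_0)
qed

text \<open>
  Both identities hold in the model \<open>su_perp\<close>: the centre of \<open>SU(3)\<close> acts trivially on it, and it
  contains no invariants of the tetrahedral group.
\<close>

lemma block8_properties:
  assumes "w \<in> block8 hat e u"
  shows "actW hat e center w = w \<and> group_sum (actW hat e) w = 0"
proof -
  let ?S = "{w. actW hat e center w = w \<and> group_sum (actW hat e) w = 0}"
  have "block8 hat e u \<subseteq> ?S"
    unfolding block8_def
  proof (rule isotypic_component_subset)
    fix U x
    assume U: "submodule (SU3 hat u) (actW hat e) U"
      "module_iso (SU3 hat u) (actW hat e) U (actEnd hat) (su_perp hat e u)" and x: "x \<in> U"
    obtain \<phi> where \<phi>: "linear \<phi>" "inj_on \<phi> U" "\<And>x. x \<in> U \<Longrightarrow> \<phi> x \<in> su_perp hat e u"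
      "\<And>g x. g \<in> SU3 hat u \<Longrightarrow> x \<in> U \<Longrightarrow> \<phi> (actW hat e g x) = actEnd hat g (\<phi> x)"
      "\<And>g x. g \<in> SU3 hat u \<Longrightarrow> x \<in> U \<Longrightarrow> \<phi> (dup (actW hat e) g x) = dup (actEnd hat) g (\<phi> x)"
      "\<And>g x. g \<in> SU3 hat u \<Longrightarrow> x \<in> U \<Longrightarrow> \<phi> (tri (actW hat e) g x) = tri (actEnd hat) g (\<phi> x)"
      using module_iso_transfer [OF U] by metis
    note in_U = submodule_dup_tri [OF U(1)]
    have 0: "0 \<in> U" and cx: "actW hat e center x \<in> U"
      using U(1) x elements_SU3(1) by (auto simp: submodule_def subspace_0)
    have "\<phi> (actW hat e center x) = \<phi> x"
      using \<phi>(3,4) x elements_SU3(1) center_su_perp by simp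
    moreover have "\<phi> (group_sum (actW hat e) x) = \<phi> 0"
      using group_sum_su_perp [OF \<phi>(3) [OF x]] x elements_SU3 in_U linear_0 [OF \<phi>(1)]
      by (simp add: group_sum_def \<phi>(5,6))
    moreover have "group_sum (actW hat e) x \<in> U"
      using x elements_SU3 in_U by (simp add: group_sum_def)
    ultimately show "x \<in> ?S"
      using \<phi>(2) x 0 cx by (auto dest: inj_onD)
  next
    have "linear (group_sum (actW hat e))" using group_sum_linear actW_linear_SU3 by blast
    moreover have "linear (actW hat e center)" using actW_linear_SU3 elements_SU3(1) by blast
    ultimately show "subspace ?S"
      by (auto simp: subspace_def linear_add linear_scale linear_0)
  qed
  then show ?thesis using assms by blast
qed

text \<open>
  The first identity above leaves only \<open>c\<close> and \<open>A\<close>, the second removes \<open>c\<close> and the trace of \<open>A\<close>.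
\<close>

lemma block8_coords:
  assumes "w \<in> block8 hat e u"
  obtains A where "coords w 0 0 0 0 A 0" "trace A = 0"
proof -
  obtain c d p q A B where w: "coords w c d p q A B" using coords_ex by blast
  then have w: "coords w c 0 0 0 A 0"
    using center_fixed_coords [OF w] block8_properties [OF assms] by auto
  have "12 * c = 0 \<and> mat (4 * trace A) = (0 :: complex^3^3)"
    using coords_eqD [OF coords_group_sum [OF w]] coords_0 block8_properties [OF assms] by metis
  moreover have "(mat (4 * trace A) :: complex^3^3) $ 1 $ 1 = 4 * trace A" by (simp add: mat_def)
  ultimately have "c = 0" "trace A = 0" by auto
  then show ?thesis using that w by blast
qed

text \<open>
  For fixed nonzero \<open>r\<close> these elements form a copy of \<open>su_perp\<close> in \<open>W\<close>, because left
  multiplication by the slice commutes with the stabilizer of \<open>u\<close>.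
\<close>

definition scaled_endo :: "complex \<Rightarrow> ('v \<Rightarrow>\<^sub>L 'v) \<Rightarrow> W" where
  "scaled_endo r A = (\<chi> j. \<psi> (oct r 0) \<odot> hat (A (e j)))"

lemma ev_scaled_endo: "ev (scaled_endo r A) v = \<psi> (oct r 0) \<odot> hat (A v)"
  unfolding scaled_endo_def
  by (rule ev_of_linear [of "\<lambda>v. \<psi> (oct r 0) \<odot> hat (A v)"], intro linearI)
    (simp_all add: blinfun.add_right blinfun.scaleR_right linear_add [OF hat_linear]
      linear_scale [OF hat_linear] omult_simps)

lemma scaled_endo_linear: "linear (scaled_endo r)"
  by (intro linearI) (simp_all add: scaled_endo_def vec_eq_iff blinfun.add_left blinfun.scaleR_left
      linear_add [OF hat_linear] linear_scale [OF hat_linear] omult_simps)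

lemma coords_scaled_endo:
  assumes "endo A K" shows "coords (scaled_endo r A) 0 0 0 0 (cscale r K) 0"
  unfolding coords_def
proof (intro allI)
  fix t x
  have "inv \<psi> (ev (scaled_endo r A) (pt t x)) = oct r 0 \<odot> oct (Complex 0 0) (K *v x)"
    by (simp add: ev_scaled_endo endoD [OF assms] hat_pt inv_psi_simps)
  then show "inv \<psi> (ev (scaled_endo r A) (pt t x)) = oct (of_real t * 0 + dot 0 x + dot 0 (cvec x))
      (t *\<^sub>R 0 + cscale r K *v x + 0 *v cvec x)"
    by (simp add: oct_mult coordinate_defs herm_def conj_cross_def vec3_eq_iff complex_eq_iff algebra_simps)
qed

lemma actW_scaled_endo:
  assumes g: "g \<in> SU3 hat u" shows "actW hat e g (scaled_endo r A) = scaled_endo r (actEnd hat g A)"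
  by (rule ev_eqI)
    (simp add: ev_actW SU3_G2 [OF g] ev_scaled_endo G2_mult SU3_psi_complex [OF g] actEnd_apply hat_actV)

lemma scaled_endo_in_block8:
  assumes "r \<noteq> 0" and A: "A \<in> su_perp hat e u"
  shows "scaled_endo r A \<in> block8 hat e u"
  unfolding block8_def
proof (rule isotypic_componentI)
  let ?U = "scaled_endo r ` su_perp hat e u"
  show "submodule (SU3 hat u) (actW hat e) ?U"
    unfolding submodule_def
    using linear_subspace_image [OF scaled_endo_linear subspace_su_perp] actEnd_su_perp by (auto simp: actW_scaled_endo)
  have inj: "inj_on (scaled_endo r) (su_perp hat e u)"
  proof (rule inj_onI)
    fix A B assume "A \<in> su_perp hat e u" "B \<in> su_perp hat e u" and eq: "scaled_endo r A = scaled_endo r B"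
    then obtain K L where KL: "endo A K" "endo B L" by (metis su_perp_endo)
    then have "cscale r K = cscale r L" using coords_scaled_endo [of A K r] coords_scaled_endo [of B L r] coords_eqD eq by metis
    then have "K = L" using \<open>r \<noteq> 0\<close> by (simp add: cscale_def vec_eq_iff)
    then show "A = B" using KL endo_eqI by blast
  qed
  obtain \<phi> where \<phi>: "linear \<phi>" "\<And>A. A \<in> su_perp hat e u \<Longrightarrow> \<phi> (scaled_endo r A) = A"
    using linear_exists_left_inverse_on [OF scaled_endo_linear subspace_su_perp inj] by blast
  then have "bij_betw \<phi> ?U (su_perp hat e u)"
    by (intro bij_betw_byWitness [where f' = "scaled_endo r"]) auto
  then show "module_iso (SU3 hat u) (actW hat e) ?U (actEnd hat) (su_perp hat e u)"
    unfolding module_iso_def using \<phi> actEnd_su_perp by (intro exI [of _ \<phi>]) (auto simp: actW_scaled_endo)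
  show "scaled_endo r A \<in> ?U" using A by blast
qed

lemma block8_contributes:
  "contributes hat e (block8 hat e u) (slice_point hat u \<mu> Q) \<longleftrightarrow> (\<mu>, Q) \<in> circle"
proof
  assume "contributes hat e (block8 hat e u) (slice_point hat u \<mu> Q)"
  then obtain w where w: "w \<in> block8 hat e u" "w \<noteq> 0" "h hat e w = rmul e (slice_point hat u \<mu> Q) w"
    unfolding contributes_def by blast
  obtain A where A: "coords w 0 0 0 0 A 0" "trace A = 0" using block8_coords [OF w(1)] by blast
  then have "A \<noteq> 0" using coords_inj [OF _ coords_0] w(2) by blast
  then show "(\<mu>, Q) \<in> circle" using eigen_adjoint [OF A w(3)] by blast
next
  assume "(\<mu>, Q) \<in> circle"
  then obtain r where r: "r \<noteq> 0"
    "\<And>w K. coords w 0 0 0 0 (cscale r K) 0 \<Longrightarrow> adjoint_mat K = - K \<Longrightarrow> trace K = 0 \<Longrightarrow>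
      h hat e w = rmul e (slice_point hat u \<mu> Q) w"
    using circle_eigenvector by metis
  define K :: "complex^3^3" where
    "K = vector [vector [\<i>, 0, 0], vector [0, - \<i>, 0], vector [0, 0, 0]]"
  have K: "adjoint_mat K = - K" "trace K = 0"
    by (simp_all add: K_def adjoint_mat_def trace_def sum_3 vec3_eq_iff)
  obtain A where A: "endo A K" using endo_ex by blast
  then have "A \<in> su_perp hat e u" using su_perp_iff K by blast
  then have "scaled_endo r A \<in> block8 hat e u" using scaled_endo_in_block8 r(1) by blast
  moreover have "scaled_endo r A \<noteq> 0"
  proof
    assume "scaled_endo r A = 0"
    then have "cscale r K = 0" using coords_eqD [OF coords_scaled_endo [OF A, of r]] coords_0 by metis
    then show False using r(1) by (simp add: cscale_def K_def vec3_eq_iff)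
  qed
  moreover have "h hat e (scaled_endo r A) = rmul e (slice_point hat u \<mu> Q) (scaled_endo r A)"
    using r(2) [OF coords_scaled_endo [OF A] K] .
  ultimately show "contributes hat e (block8 hat e u) (slice_point hat u \<mu> Q)"
    unfolding contributes_def by blast
qed

lemma right_eigenvalue_iff:
  "right_eigenvalue hat e (slice_point hat u \<mu> Q) \<longleftrightarrow> (\<mu>, Q) \<in> quartic \<or> (\<mu>, Q) \<in> circle"
  using eigen_locus block1_contributes block8_contributes
  unfolding right_eigenvalue_def contributes_def by metis

end

section \<open>The right eigenvalues in the slice\<close>

theorem theorem7p1:
  fixes hat :: "'v::euclidean_space \<Rightarrow> octonion"
    and e :: "7 \<Rightarrow> 'v"
    and u :: 'v
  assumes "isometric_identification hat"
    and "orthonormal_basis e"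
    and "norm u = 1"
  shows
    "(\<forall>\<mu> Q. right_eigenvalue hat e (slice_point hat u \<mu> Q) \<longleftrightarrow>
        (\<mu>, Q) \<in> quartic \<or> (\<mu>, Q) \<in> circle) \<and>
     (\<forall>\<mu> Q. contributes hat e (block1 hat e u) (slice_point hat u \<mu> Q) \<longleftrightarrow> (\<mu>, Q) \<in> quartic) \<and>
     (\<forall>\<mu> Q. contributes hat e (block8 hat e u) (slice_point hat u \<mu> Q) \<longleftrightarrow> (\<mu>, Q) \<in> circle) \<and>
     (\<forall>\<mu> Q. Q \<noteq> 0 \<longrightarrow>
        \<not> contributes hat e (block6 hat e u) (slice_point hat u \<mu> Q) \<and>
        \<not> contributes hat e (block12 hat e u) (slice_point hat u \<mu> Q)) \<and>
     (\<forall>\<mu> Q. Q \<noteq> 0 \<longrightarrow>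
        (right_eigenvalue hat e (slice_point hat u \<mu> Q) \<longleftrightarrow>
         (\<mu>, Q) \<in> quartic \<or> (\<mu>, Q) \<in> circle))"
proof -
  interpret imaginary_octonions hat e using assms by unfold_locales
  have "oct \<i> 0 \<in> ImO" "norm (oct \<i> 0) = 1"
    by (simp_all add: norm_eq_1 inner_oct herm_def)
  then obtain \<psi> where "\<psi> \<in> G2" "\<psi> (oct \<i> 0) = hat u"
    using G2_transitive hat_ImO hat_norm assms(3) by metis
  then interpret slice hat e u \<psi> by unfold_locales
  show ?thesis
    using right_eigenvalue_iff block1_contributes block8_contributes
      tri_not_contributes block6_tri block12_tri by auto
qed

end
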